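(* Let $(Z_n)_{n\ge0}$ be a Galton--Watson process with $Z_0=1$ and offspring distribution $F$ on $\{0,1,2,\dots\}$ with mean $m:=\mathbb E\xi>1$, and let $W_n:=Z_n/m^n$ and $W:=\lim_{n\to\infty}W_n$ (almost sure limit). Assume $F$ is dominated varying, i.e. $\sup_x \overline F(x/2)/\overline F(x)<\infty$, and that for some $\delta>0$ and $c<\infty$, $$\overline F(xy)\le c\,\overline F(x)/y^{1+\delta}\quad\text{for all } x,y>1.$$ Then there exist constants $c_1>0$ and $c_2<\infty$ such that $$c_1\overline F(x)\le \Pr\{W_n>x\}\le c_2\overline F(x)\quad\text{for all } x,\ n.$$ If, in addition, $F$ is intermediate regularly varying, then, uniformly in $n\ge1$, $$\Pr\{W_n>x\}\sim\sum_{i=0}^{n-1}m^i\overline F(m^{i+1}x)\quad\text{as }x\to\infty;$$ in particular $$\Pr\{W_n>x\}\sim\sum_{i=0}^{\infty}m^i\overline F(m^{i+1}x)\quad\text{as }x,n\to\infty,$$ and $$\Pr\{W>x\}\sim\sum_{i=0}^{\infty}m^i\overline F(m^{i+1}x)\quad\text{as }x\to\infty.$$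
   Context: The process is defined by $Z_{n+1}=\sum_{i=1}^{Z_n}\xi_i^{(n)}$, where $\xi_i^{(n)}$, $i\ge1$, $n\ge0$, are i.i.d. copies of a random variable $\xi$ with distribution $F$ on $\{0,1,2,\dots\}$; $\overline F(x):=\Pr\{\xi>x\}$ for real $x$. $f(x)\sim g(x)$ means $f(x)/g(x)\to1$. A distribution $F$ is intermediate regularly varying if $\lim_{\varepsilon\downarrow0}\liminf_{x\to\infty}\overline F(x(1+\varepsilon))/\overline F(x)=1$. "Uniformly in $n$" means the ratio of the two sides tends to $1$ as $x\to\infty$ uniformly over $n\ge1$.
   Formalization: The two-sided bound is stated for all real x and all n ≥ 1; for n = 0 one has W_0 = 1, so Pr{W_0 > x} = 0 < F̄(x) for x ≥ 1 and the lower bound fails. *)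

theory Defs
  imports "HOL-Probability.Probability" "HOL-Library.Landau_Symbols"
begin

definition Fbar :: "nat pmf \<Rightarrow> real \<Rightarrow> real" where
  "Fbar F x = measure_pmf.prob F {k. real k > x}"

definition offspring_mean :: "nat pmf \<Rightarrow> real" where
  "offspring_mean F = measure_pmf.expectation F real"

fun gw_Z :: "(nat \<Rightarrow> nat \<Rightarrow> 'a \<Rightarrow> nat) \<Rightarrow> nat \<Rightarrow> 'a \<Rightarrow> nat" where
  "gw_Z xi 0 \<omega> = 1"
| "gw_Z xi (Suc n) \<omega> = (\<Sum>i\<in>{1..gw_Z xi n \<omega>}. xi i n \<omega>)"

definition gw_W :: "(nat \<Rightarrow> nat \<Rightarrow> 'a \<Rightarrow> nat) \<Rightarrow> real \<Rightarrow> nat \<Rightarrow> 'a \<Rightarrow> real" where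
  "gw_W xi m n \<omega> = real (gw_Z xi n \<omega>) / m ^ n"

definition gw_Wlim :: "(nat \<Rightarrow> nat \<Rightarrow> 'a \<Rightarrow> nat) \<Rightarrow> real \<Rightarrow> 'a \<Rightarrow> real" where
  "gw_Wlim xi m \<omega> = lim (\<lambda>n. gw_W xi m n \<omega>)"

definition dominated_varying :: "nat pmf \<Rightarrow> bool" where
  "dominated_varying F \<longleftrightarrow> (\<exists>C. \<forall>x. Fbar F (x / 2) \<le> C * Fbar F x)"

definition intermediate_regularly_varying :: "nat pmf \<Rightarrow> bool" where
  "intermediate_regularly_varying F \<longleftrightarrow>
     ((\<lambda>\<epsilon>. Liminf at_top (\<lambda>x. ereal (Fbar F (x * (1 + \<epsilon>)) / Fbar F x))) \<longlongrightarrow> 1) (at_right 0)"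

end

theory Submission
  imports Defs
begin

text \<open>
  Everything reduces to the Markov chain \<open>Z\<^bsub>n+1\<^esub> = S(Z\<^bsub>n\<^esub>)\<close>, where \<open>S(k)\<close> is a sum of \<open>k\<close> independent copies
  of \<open>\<xi>\<close>. A moment of some order \<open>p \<in> (1, 2]\<close> gives a Fuk--Nagaev bound for the upper tail of
  \<open>S(k) - k m\<close> and the bound \<open>C k / y\<^sup>p\<close> for both tails. Choosing \<open>q < 1\<close> with \<open>(m q)\<^sup>p = m / q\<close> and comparing
  \<open>W\<^bsub>n+1\<^esub>\<close> at level \<open>x (1 \<mp> O(q\<^bsup>n+1\<^esup>))\<close> with \<open>W\<^bsub>n\<^esub>\<close> at level \<open>x (1 \<mp> O(q\<^sup>n))\<close>, each generation costs an
  error of at most \<open>C q\<^sup>n\<close> times the offspring tail. Hence the tail of \<open>W\<^bsub>n\<^esub>\<close> is sandwiched between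
  the tails of \<open>W\<^bsub>N\<^esub>\<close> at \<open>x (1 \<plusminus> O(q\<^sup>N))\<close> up to an error that is small uniformly in \<open>n \<ge> N\<close>. For fixed
  \<open>N\<close> the asymptotics follow by induction on \<open>N\<close>: either \<open>W\<^bsub>N\<^esub>\<close> is already large, or \<open>Z\<^bsub>N\<^esub>\<close> is bounded and
  one individual of that generation has more than \<open>m\<^bsup>N+1\<^esup> x\<close> children, which contributes the term
  with index \<open>i = N\<close> since \<open>E Z\<^bsub>N\<^esub> = m\<^sup>N\<close>. The summable deviation bounds also give the
  almost sure convergence of \<open>W\<^bsub>n\<^esub>\<close>, by Borel--Cantelli.
\<close>

section \<open>Sums of independent copies\<close>

text \<open>The errors must be small compared with \<open>Fbar F x\<close>, while the offspring law
  is only known to have moments of some order \<open>p\<close> slightly above 1. Dominated variation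
  bounds \<open>Fbar F x\<close> below by a power of \<open>x\<close>, so a deviation bound is
  useful once its second term can be raised to an arbitrarily high power: this is what the free
  parameter \<open>r\<close> of the Fuk--Nagaev bound provides. From below the loss is a factor
  multiplying the tail of \<open>W_n\<close> itself, and the plain \<open>p\<close>-th moment bound
  is enough. The equation for \<open>q\<close> balances two requirements: in a generation of mean
  size \<open>m^n\<close> a deviation of order \<open>(m q)^n\<close> has probability of order at
  most \<open>m^n / (m q)^(n p) = q^n\<close>, and after division by \<open>m^n\<close> it moves the
  level by order \<open>q^n\<close>. Shifts of level and errors are then both geometric series,
  which makes the comparison uniform in \<open>n\<close>.\<close>

lemma integrable_measure_pmf_bounded:
  fixes f :: "'a \<Rightarrow> real"
  assumes "\<And>x. \<bar>f x\<bar> \<le> B"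
  shows "integrable (measure_pmf p) f"
  by (rule measure_pmf.integrable_const_bound[where B=B]) (use assms in auto)

lemma integrable_measure_pmf_prob [simp]:
  "integrable (measure_pmf p) (\<lambda>x. measure_pmf.prob (q x) (A x))"
  by (rule integrable_measure_pmf_bounded[where B=1]) auto

lemma measure_pmf_prob_bind:
  "measure_pmf.prob (bind_pmf p f) A = measure_pmf.expectation p (\<lambda>x. measure_pmf.prob (f x) A)"
proof -
  have "ennreal (measure_pmf.prob (bind_pmf p f) A) = (\<integral>\<^sup>+x. ennreal (measure_pmf.prob (f x) A) \<partial>p)"
    by (simp add: measure_pmf.emeasure_eq_measure[symmetric])
  also have "\<dots> = ennreal (measure_pmf.expectation p (\<lambda>x. measure_pmf.prob (f x) A))"
    by (rule nn_integral_eq_integral) auto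
  finally show ?thesis
    by (subst (asm) ennreal_inj) (auto intro!: integral_nonneg_AE)
qed

lemma expectation_indicator_pmf:
  "measure_pmf.expectation p (\<lambda>x. if P x then 1 else 0) = measure_pmf.prob p {x. P x}"
proof -
  have "(\<lambda>x. if P x then 1 else 0 :: real) = indicator {x. P x}"
    by (auto simp: indicator_def)
  then show ?thesis by simp
qed

fun sum_pmf :: "nat pmf \<Rightarrow> nat \<Rightarrow> nat pmf" where
  "sum_pmf F 0 = return_pmf 0"
| "sum_pmf F (Suc k) = bind_pmf F (\<lambda>a. map_pmf ((+) a) (sum_pmf F k))"

lemma prob_sum_pmf_Suc:
  "measure_pmf.prob (sum_pmf F (Suc k)) A =
    measure_pmf.expectation F (\<lambda>a. measure_pmf.prob (sum_pmf F k) {b. a + b \<in> A})"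
  by (simp add: measure_pmf_prob_bind vimage_def)

lemma Fbar_nonneg [simp]: "Fbar F x \<ge> 0"
  by (simp add: Fbar_def)

lemma Fbar_le_1 [simp]: "Fbar F x \<le> 1"
  by (simp add: Fbar_def)

lemma Fbar_antimono: "x \<le> y \<Longrightarrow> Fbar F y \<le> Fbar F x"
  unfolding Fbar_def by (rule measure_pmf.finite_measure_mono) auto

lemma Fbar_neg: "x < 0 \<Longrightarrow> Fbar F x = 1"
proof -
  assume "x < 0"
  then have "{k. x < real k} = UNIV" by (auto intro: less_le_trans)
  then show ?thesis by (simp add: Fbar_def)
qed

text \<open>If \<open>a + b > x\<close> and neither summand exceeds \<open>x * (1 - \<eta>)\<close>,
  then both exceed \<open>\<eta> * x\<close>; independence turns this last case into a product of
  two tails. The lower bound is inclusion--exclusion for the events that one summand alone exceeds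
  \<open>x\<close>.\<close>

lemma sum_pmf_Suc_window:
  shows "measure_pmf.prob (sum_pmf F (Suc k)) {b. real b > x}
    \<le> Fbar F (x * (1 - \<eta>)) + measure_pmf.prob (sum_pmf F k) {b. real b > x * (1 - \<eta>)}
      + Fbar F (\<eta> * x) * measure_pmf.prob (sum_pmf F k) {b. real b > \<eta> * x}" (is ?upper)
   and "Fbar F x + measure_pmf.prob (sum_pmf F k) {b. real b > x}
      - Fbar F x * measure_pmf.prob (sum_pmf F k) {b. real b > x}
    \<le> measure_pmf.prob (sum_pmf F (Suc k)) {b. real b > x}" (is ?lower)
proof -
  let ?P = "pair_pmf F (sum_pmf F k)"
  have Suc: "measure_pmf.prob (sum_pmf F (Suc k)) A = measure_pmf.prob ?P {(a, b). a + b \<in> A}" for A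
    by (simp add: pair_pmf_def map_pmf_def measure_pmf_prob_bind indicator_def vimage_def)
  have fst: "measure_pmf.prob ?P {(a, b). real a > t} = Fbar F t" for t
  proof -
    have "Fbar F t = measure_pmf.prob (map_pmf fst ?P) {a. real a > t}" by (simp add: map_fst_pair_pmf Fbar_def)
    also have "\<dots> = measure_pmf.prob ?P {(a, b). real a > t}"
      unfolding measure_map_pmf by (rule arg_cong[where f="measure_pmf.prob ?P"]) auto
    finally show ?thesis by simp
  qed
  have snd: "measure_pmf.prob ?P {(a, b). real b > t} = measure_pmf.prob (sum_pmf F k) {b. real b > t}" for t
  proof -
    have "measure_pmf.prob (sum_pmf F k) {b. real b > t} = measure_pmf.prob (map_pmf snd ?P) {a. real a > t}" by (simp add: map_snd_pair_pmf)
    also have "\<dots> = measure_pmf.prob ?P {(a, b). real b > t}"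
      unfolding measure_map_pmf by (rule arg_cong[where f="measure_pmf.prob ?P"]) auto
    finally show ?thesis by simp
  qed
  have both: "measure_pmf.prob ?P ({(a, b). real a > t} \<inter> {(a, b). real b > t}) = Fbar F t * measure_pmf.prob (sum_pmf F k) {b. real b > t}" for t
  proof -
    have "{(a, b). real a > t} \<inter> {(a, b). real b > t} = {a. real a > t} \<times> {b. real b > t}" by auto
    then show ?thesis by (simp add: measure_pmf_prob_product Fbar_def)
  qed
  have "measure_pmf.prob ?P {(a, b). a + b \<in> {b. real b > x}} \<le>
     measure_pmf.prob ?P ({(a, b). real a > x * (1 - \<eta>)} \<union> {(a, b). real b > x * (1 - \<eta>)} \<union> ({(a, b). real a > \<eta> * x} \<inter> {(a, b). real b > \<eta> * x}))"
    by (rule measure_pmf.finite_measure_mono) (auto simp: algebra_simps)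
  also have "\<dots> \<le> measure_pmf.prob ?P {(a, b). real a > x * (1 - \<eta>)} + measure_pmf.prob ?P {(a, b). real b > x * (1 - \<eta>)} + measure_pmf.prob ?P ({(a, b). real a > \<eta> * x} \<inter> {(a, b). real b > \<eta> * x})"
    by (intro order_trans[OF measure_Un_le] add_mono order_refl) auto
  finally show ?upper by (simp only: Suc fst snd both)
  have "measure_pmf.prob ?P ({(a, b). real a > x} \<union> {(a, b). real b > x}) \<le> measure_pmf.prob ?P {(a, b). a + b \<in> {b. real b > x}}"
    by (rule measure_pmf.finite_measure_mono) auto
  moreover have "measure_pmf.prob ?P ({(a, b). real a > x} \<union> {(a, b). real b > x}) = measure_pmf.prob ?P {(a, b). real a > x} +  measure_pmf.prob ?P {(a, b). real b > x} - measure_pmf.prob ?P ({(a, b). real a > x} \<inter> {(a, b). real b > x})"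
    by (intro measure_Un3) (simp_all add: measure_pmf.fmeasurable_eq_sets)
  ultimately show ?lower by (simp only: Suc fst snd both)
qed

text \<open>Markov's inequality for the truncated exponential, by conditioning on the first summand:
  a summand above \<open>u\<close> is charged \<open>Fbar F u\<close>, any other contributes the
  factor \<open>exp (s * real a)\<close>, so each step adds one tail and one power of the
  unnormalised transform \<open>\<phi>\<close>.\<close>

lemma sum_pmf_upper_exp:
  fixes F :: "nat pmf" and s u :: real
  assumes "s \<ge> 0"
  defines "\<phi> \<equiv> measure_pmf.expectation F (\<lambda>j. if real j \<le> u then exp (s * real j) else 0)"
  shows "measure_pmf.prob (sum_pmf F k) {b. real b > t} \<le> real k * Fbar F u + exp (- s * t) * \<phi> ^ k"
proof (induction k arbitrary: t)
  case 0
  show ?case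
    using assms(1) by (auto simp: indicator_def mult_nonneg_nonpos)
next
  case (Suc k)
  have int: "integrable F (\<lambda>j. if real j \<le> u then exp (s * real j) else 0)"
    by (rule integrable_measure_pmf_bounded[where B="exp (s * u)"]) (use assms(1) in \<open>auto intro: mult_left_mono\<close>)
  have phi0: "\<phi> \<ge> 0"
    unfolding \<phi>_def by (rule integral_nonneg_AE) auto
  have int1: "integrable F (\<lambda>a. if u < real a then 1 else 0 :: real)"
    by (rule integrable_measure_pmf_bounded[where B=1]) auto
  have "measure_pmf.prob (sum_pmf F (Suc k)) {b. real b > t}
      = measure_pmf.expectation F (\<lambda>a. measure_pmf.prob (sum_pmf F k) {b. a + b \<in> {b. real b > t}})"
    by (rule prob_sum_pmf_Suc)
  also have "\<dots> \<le> measure_pmf.expectation F (\<lambda>a. (if u < real a then 1 else 0) + (real k * Fbar F u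
         + (exp (- s * t) * \<phi> ^ k) * (if real a \<le> u then exp (s * real a) else 0)))"
  proof (rule integral_mono)
    fix a
    have *: "measure_pmf.prob (sum_pmf F k) {b. a + b \<in> {b. real b > t}} \<le>
        real k * Fbar F u + exp (- s * (t - real a)) * \<phi> ^ k"
      using Suc.IH[of "t - real a"] by (simp add: algebra_simps)
    show "measure_pmf.prob (sum_pmf F k) {b. a + b \<in> {b. real b > t}} \<le> (if u < real a then 1 else 0) + (real k * Fbar F u
         + (exp (- s * t) * \<phi> ^ k) * (if real a \<le> u then exp (s * real a) else 0))"
    proof (cases "real a \<le> u")
      case True
      then show ?thesis using * by (simp add: exp_minus algebra_simps exp_diff divide_inverse)
    next
      case False
      have "measure_pmf.prob (sum_pmf F k) {b. a + b \<in> {b. real b > t}} \<le> 1" by simp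
      then show ?thesis using False by (simp add: add_increasing2)
    qed
  qed (use int int1 in auto)
  also have "\<dots> = Fbar F u + (real k * Fbar F u + exp (- s * t) * \<phi> ^ k * \<phi>)"
    using int int1 by (simp add: expectation_indicator_pmf Fbar_def \<phi>_def)
  also have "\<dots> = real (Suc k) * Fbar F u + exp (- s * t) * \<phi> ^ Suc k"
    by (simp add: algebra_simps)
  finally show ?case .
qed

lemma sum_pmf_lower_exp:
  fixes F :: "nat pmf" and s :: real
  assumes "s \<ge> 0"
  defines "\<phi> \<equiv> measure_pmf.expectation F (\<lambda>j. exp (- s * real j))"
  shows "measure_pmf.prob (sum_pmf F k) {b. real b \<le> t} \<le> exp (s * t) * \<phi> ^ k"
proof (induction k arbitrary: t)
  case 0
  show ?case
    using assms(1) by (auto simp: indicator_def)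
next
  case (Suc k)
  have int: "integrable F (\<lambda>j. exp (- s * real j))"
    by (rule integrable_measure_pmf_bounded[where B="1"]) (use assms(1) in auto)
  have "measure_pmf.prob (sum_pmf F (Suc k)) {b. real b \<le> t}
      = measure_pmf.expectation F (\<lambda>a. measure_pmf.prob (sum_pmf F k) {b. a + b \<in> {b. real b \<le> t}})"
    by (rule prob_sum_pmf_Suc)
  also have "\<dots> \<le> measure_pmf.expectation F (\<lambda>a. (exp (s * t) * \<phi> ^ k) * exp (- s * real a))"
  proof (rule integral_mono)
    fix a
    have "measure_pmf.prob (sum_pmf F k) {b. a + b \<in> {b. real b \<le> t}} \<le> exp (s * (t - real a)) * \<phi> ^ k"
      using Suc.IH[of "t - real a"] by (simp add: algebra_simps)
    then show "measure_pmf.prob (sum_pmf F k) {b. a + b \<in> {b. real b \<le> t}} \<le> (exp (s * t) * \<phi> ^ k) * exp (- s * real a)"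
      by (simp add: exp_add[symmetric] exp_minus algebra_simps exp_diff divide_inverse)
  qed (use int in auto)
  also have "\<dots> = exp (s * t) * \<phi> ^ Suc k"
    using int by (simp add: \<phi>_def algebra_simps)
  finally show ?case .
qed

section \<open>Elementary bounds for the exponential\<close>

lemma exp_quadratic_upper:
  assumes "z \<ge> (0::real)" shows "exp z \<le> 1 + z + z\<^sup>2 * exp z"
proof -
  \<comment> \<open>This yields \<open>exp z \<le> 1 + z * exp z\<close>; inserting that into its
    own right-hand side gives the claim.\<close>
  have "exp z * (1 - z) \<le> exp z * exp (- z)"
    using exp_ge_add_one_self[of "-z"] by (intro mult_left_mono) auto
  then have a: "exp z * (1 - z) \<le> 1" by (simp add: exp_minus)
  have "z * (exp z * (1 - z)) \<le> z * 1"
    using a assms by (intro mult_left_mono) auto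
  with a show ?thesis by (simp add: algebra_simps power2_eq_square)
qed

lemma square_le_exp:
  assumes "z \<ge> (0::real)" shows "z\<^sup>2 \<le> 2 * exp z"
  using exp_lower_Taylor_quadratic[OF assms] assms by (simp add: field_simps)

text \<open>For \<open>z \<le> 1\<close> the second-order bound suffices because
  \<open>z\<^sup>2 \<le> z powr p\<close>; for larger \<open>z\<close> the term
  \<open>z powr p\<close> already outweighs \<open>z\<close>.\<close>

lemma exp_minus_upper:
  assumes "z \<ge> (0::real)" "1 \<le> p" "p \<le> 2"
  shows "exp (- z) \<le> 1 - z + z powr p"
proof (cases "z \<le> 1")
  case True
  have "z\<^sup>2 \<le> z powr p"
    using True assms powr_mono'[of p 2 z] by (cases "z = 0") (auto simp: powr_numeral)
  moreover have "exp (- z) \<le> 1 / (1 + z)"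
    using exp_ge_add_one_self[of z] assms by (simp add: exp_minus field_simps)
  moreover have "1 / (1 + z) \<le> 1 - z + z\<^sup>2"
    using assms by (simp add: field_simps power2_eq_square) 
  ultimately show ?thesis by linarith
next
  case False
  have "z powr 1 \<le> z powr p" using False assms by (intro powr_mono) auto
  then have "z \<le> z powr p" using False by simp
  moreover have "exp (- z) \<le> 1" using assms by simp
  ultimately show ?thesis by linarith
qed

lemma powr_le_exp:
  assumes "w > (0::real)" "0 \<le> p" "p \<le> 2"
  shows "w powr p \<le> 2 * exp w"
proof (cases "w \<le> 1")
  case True
  have "w powr p \<le> 1" using True assms by (simp add: powr_le1)
  moreover have "1 \<le> exp w" using assms by simp
  ultimately show ?thesis by linarith
next
  case False
  have "w powr p \<le> w powr 2" using False assms by (intro powr_mono) auto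
  then show ?thesis using square_le_exp[of w] assms by (simp add: powr_numeral)
qed

section \<open>Fuk--Nagaev and moment bounds for sums\<close>

locale moment_offspring =
  fixes F :: "nat pmf" and m p V :: real
  assumes m_def: "m = offspring_mean F"
    and p_gt1: "1 < p" and p_le2: "p \<le> 2"
    and int_p: "integrable F (\<lambda>j. real j powr p)"
    and V_ge: "measure_pmf.expectation F (\<lambda>j. real j powr p) \<le> V"
    and V_pos: "V > 0"
begin

lemma integrable_real: "integrable F real"
proof (rule Bochner_Integration.integrable_bound[OF int_p])
  have "norm (real j) \<le> norm (real j powr p)" for j
  proof (cases "j = 0")
    case False
    then have "real j powr 1 \<le> real j powr p" using p_gt1 by (intro powr_mono) auto
    then show ?thesis using False by simp
  qed auto
  then show "AE j in F. norm (real j) \<le> norm (real j powr p)" by simp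
qed auto

lemma m_eq: "measure_pmf.expectation F real = m"
  by (simp add: m_def offspring_mean_def)

text \<open>Below the truncation level \<open>j^2\<close> is at most \<open>j^p\<close> times
  \<open>u^(2 - p)\<close>, so the \<open>p\<close>-th moment controls the second-order remainder of
  the exponential. The leftover \<open>(s * u)\<^sup>2\<close> is absorbed by another factor
  \<open>exp (s * u)\<close>, whence \<open>2 * s * u\<close> in the exponent.\<close>

lemma truncated_exp_moment:
  assumes "s \<ge> 0" "u > 0"
  shows "measure_pmf.expectation F (\<lambda>j. if real j \<le> u then exp (s * real j) else 0)
     \<le> exp (s * m + 2 * exp (2 * s * u) * V / u powr p)"
proof -
  let ?C = "2 * exp (2 * s * u) / u powr p"
  have "measure_pmf.expectation F (\<lambda>j. if real j \<le> u then exp (s * real j) else 0)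
     \<le> measure_pmf.expectation F (\<lambda>j. 1 + s * real j + ?C * real j powr p)"
  proof (rule integral_mono)
    show "integrable F (\<lambda>j. if real j \<le> u then exp (s * real j) else 0)"
      by (rule integrable_measure_pmf_bounded[where B="exp (s * u)"]) (use assms(1) in \<open>auto intro: mult_left_mono\<close>)
    fix j
    show "(if real j \<le> u then exp (s * real j) else 0) \<le> 1 + s * real j + ?C * real j powr p"
    proof (cases "real j \<le> u \<and> j \<noteq> 0")
      case True
      have "exp (s * real j) \<le> 1 + s * real j + (s * real j)\<^sup>2 * exp (s * real j)"
        using assms by (intro exp_quadratic_upper) auto
      also have "(s * real j)\<^sup>2 * exp (s * real j) \<le> ?C * real j powr p"
      proof -
        have "real j powr (2 - p) \<le> u powr (2 - p)"
          using True p_le2 by (intro powr_mono2) auto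
        then have "real j powr p * real j powr (2 - p) \<le> real j powr p * u powr (2 - p)"
          by (intro mult_left_mono) auto
        then have j2: "(real j)\<^sup>2 \<le> real j powr p * (u\<^sup>2 / u powr p)"
          using True assms by (simp add: powr_add[symmetric] powr_diff powr_numeral)
        have "(s * real j)\<^sup>2 * exp (s * real j) \<le> s\<^sup>2 * (real j powr p * (u\<^sup>2 / u powr p)) * exp (s * u)"
          unfolding power_mult_distrib using True assms j2
          by (intro mult_mono) (auto intro: mult_left_mono)
        also have "\<dots> = (s * u)\<^sup>2 * exp (s * u) * (real j powr p / u powr p)"
          by (simp add: power_mult_distrib)
        also have "\<dots> \<le> (2 * exp (s * u)) * exp (s * u) * (real j powr p / u powr p)"
          using assms square_le_exp[of "s * u"] by (intro mult_right_mono) auto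
        also have "\<dots> = ?C * real j powr p"
          by (simp add: exp_add[symmetric] algebra_simps)
        finally show ?thesis .
      qed
      finally show ?thesis using True by simp
    next
      case False
      then show ?thesis using assms by auto
    qed
  qed (use int_p integrable_real in auto)
  also have "\<dots> = 1 + s * m + ?C * measure_pmf.expectation F (\<lambda>j. real j powr p)"
    using int_p integrable_real by (simp add: m_eq)
  also have "\<dots> \<le> 1 + s * m + ?C * V"
    using V_ge by (intro add_left_mono mult_left_mono) auto
  also have "\<dots> \<le> exp (s * m + ?C * V)"
    using exp_ge_add_one_self[of "s * m + ?C * V"] by linarith
  finally show ?thesis by simp
qed

text \<open>The exponential parameter \<open>s\<close> solves \<open>exp (2 s u) = u\<^sup>p / (2 k V)\<close> with \<open>u = y / r\<close>.\<close>

lemma sum_pmf_upper_tail: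
  assumes "y > 0" "r > 0"
  shows "measure_pmf.prob (sum_pmf F k) {b. real b > real k * m + y}
    \<le> real k * Fbar F (y / r) + exp 1 * (2 * real k * V / (y / r) powr p) powr (r / 2)"
proof -
  define u where "u = y / r"
  define z where "z = 2 * real k * V / u powr p"
  have u: "u > 0" using assms by (simp add: u_def)
  \<comment> \<open>For \<open>z > 1\<close> the claimed bound exceeds 1; in the last case
    \<open>0 < z \<le> 1\<close>, so that \<open>s\<close> is well defined and nonnegative.\<close>
  consider "k = 0" | "z > 1" | "k > 0" "z \<le> 1" by linarith
  then have "measure_pmf.prob (sum_pmf F k) {b. real b > real k * m + y}
    \<le> real k * Fbar F u + exp 1 * z powr (r / 2)"
  proof cases
    case 1
    then show ?thesis using assms by (simp add: indicator_def)
  next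
    case 2
    have "1 \<le> z powr (r / 2)" using 2 assms by (intro ge_one_powr_ge_zero) auto
    moreover have "(1::real) \<le> exp 1" by simp
    ultimately have "1 * 1 \<le> exp 1 * z powr (r / 2)" by (intro mult_mono) auto
    moreover have "measure_pmf.prob (sum_pmf F k) {b. real b > real k * m + y} \<le> 1" by simp
    ultimately show ?thesis using Fbar_nonneg[of F u]
      by (smt (verit) mult_nonneg_nonneg of_nat_0_le_iff)
  next
    case 3
    have z: "z > 0" using 3 V_pos u by (simp add: z_def)
    define s where "s = - ln z / (2 * u)"
    have s: "s \<ge> 0" using z 3 u by (auto simp: s_def intro!: divide_nonpos_pos)
    have e: "exp (2 * s * u) = 1 / z"
      using u z by (simp add: s_def exp_minus field_simps)
    let ?phi = "measure_pmf.expectation F (\<lambda>j. if real j \<le> u then exp (s * real j) else 0)"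
    have "?phi \<le> exp (s * m + 2 * exp (2 * s * u) * V / u powr p)"
      by (rule truncated_exp_moment) fact+
    \<comment> \<open>The \<open>k\<close>-th power turns this \<open>1 / k\<close> per factor into
      a total factor \<open>exp 1\<close>.\<close>
    also have "2 * exp (2 * s * u) * V / u powr p = 1 / real k"
      unfolding e using 3 V_pos u by (simp add: z_def)
    finally have phi: "?phi \<le> exp (s * m + 1 / real k)" .
    have phi0: "?phi \<ge> 0" by (rule integral_nonneg_AE) auto
    have "measure_pmf.prob (sum_pmf F k) {b. real b > real k * m + y} \<le> real k * Fbar F u + exp (- s * (real k * m + y)) * ?phi ^ k"
      by (rule sum_pmf_upper_exp) fact
    also have "\<dots> \<le> real k * Fbar F u + exp (- s * (real k * m + y)) * exp (s * m + 1 / real k) ^ k"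
      using phi phi0 by (intro add_left_mono mult_left_mono power_mono) auto
    also have "exp (- s * (real k * m + y)) * exp (s * m + 1 / real k) ^ k = exp (1 - s * y)"
      using 3 by (simp add: exp_of_nat_mult[symmetric] exp_add[symmetric] algebra_simps)
    also have "\<dots> = exp 1 * z powr (r / 2)"
      using z assms by (simp add: powr_def s_def u_def exp_add[symmetric] )
    finally show ?thesis .
  qed
  then show ?thesis by (simp add: z_def u_def)
qed

lemma sum_pmf_lower_tail:
  assumes "y > 0"
  shows "measure_pmf.prob (sum_pmf F k) {b. real b \<le> real k * m - y} \<le> 2 * exp 1 * real k * V / y powr p"
proof (cases "k = 0")
  case True
  then show ?thesis using assms by (simp add: indicator_def)
next
  case False
  define t where "t = real k * V"
  have t: "t > 0" using False V_pos by (simp add: t_def)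
  \<comment> \<open>This \<open>s\<close> normalises the moment term of the \<open>k\<close>-fold
    product to 1; the remaining \<open>exp (- s * y)\<close> is at most a multiple of
    \<open>(s * y) powr (- p)\<close>.\<close>
  define s where "s = t powr (- 1 / p)"
  have s: "s > 0" using t by (simp add: s_def)
  have "s powr p = t powr (- 1)"
    unfolding s_def powr_powr using p_gt1 by simp
  then have sp: "s powr p * t = 1" using t by (simp add: powr_minus)
  let ?phi = "measure_pmf.expectation F (\<lambda>j. exp (- s * real j))"
  have phi0: "?phi \<ge> 0" by (rule integral_nonneg_AE) auto
  have "?phi \<le> measure_pmf.expectation F (\<lambda>j. 1 - s * real j + s powr p * real j powr p)"
  proof (rule integral_mono)
    show "integrable F (\<lambda>j. exp (- s * real j))"
      by (rule integrable_measure_pmf_bounded[where B="1"]) (use s in auto)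
    show "exp (- s * real j) \<le> 1 - s * real j + s powr p * real j powr p" for j
      using exp_minus_upper[of "s * real j" p] s p_gt1 p_le2 by (simp add: powr_mult)
  qed (use int_p integrable_real in auto)
  also have "\<dots> = 1 - s * m + s powr p * measure_pmf.expectation F (\<lambda>j. real j powr p)"
    using int_p integrable_real by (simp add: m_eq)
  also have "\<dots> \<le> 1 - s * m + s powr p * V"
    using V_ge by (intro add_left_mono mult_left_mono) auto
  also have "\<dots> \<le> exp (s powr p * V - s * m)"
    using exp_ge_add_one_self[of "s powr p * V - s * m"] by linarith
  finally have phi: "?phi \<le> exp (s powr p * V - s * m)" .
  have "measure_pmf.prob (sum_pmf F k) {b. real b \<le> real k * m - y} \<le> exp (s * (real k * m - y)) * ?phi ^ k"
    by (rule sum_pmf_lower_exp) (use s in simp)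
  also have "\<dots> \<le> exp (s * (real k * m - y)) * exp (s powr p * V - s * m) ^ k"
    using phi phi0 by (intro mult_left_mono power_mono) auto
  also have "\<dots> = exp (s powr p * t - s * y)"
    by (simp add: exp_of_nat_mult[symmetric] exp_add[symmetric] algebra_simps t_def)
  also have "\<dots> = exp 1 / exp (s * y)" by (simp add: sp exp_diff)
  also have "\<dots> \<le> exp 1 * (2 * t / y powr p)"
  proof -
    have "(s * y) powr p \<le> 2 * exp (s * y)"
      using s assms p_gt1 p_le2 by (intro powr_le_exp) auto
    then have "s powr p * y powr p \<le> 2 * exp (s * y)"
      using s assms by (simp add: powr_mult)
    then have "(s powr p * t) * y powr p \<le> 2 * t * exp (s * y)"
      using mult_left_mono[of "s powr p * y powr p" "2 * exp (s * y)" t] t by (simp add: algebra_simps)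
    then show ?thesis unfolding sp using assms by (simp add: field_simps)
  qed
  finally show ?thesis by (simp add: t_def algebra_simps)
qed

lemma Fbar_markov:
  assumes "t > 0" shows "Fbar F t \<le> V / t powr p"
proof -
  have "Fbar F t * t powr p = measure_pmf.expectation F (\<lambda>j. (if t < real j then 1 else 0) * t powr p)"
    by (simp add: Fbar_def expectation_indicator_pmf)
  also have "\<dots> \<le> measure_pmf.expectation F (\<lambda>j. real j powr p)"
  proof (rule integral_mono)
    show "integrable F (\<lambda>j. (if t < real j then 1 else 0) * t powr p)"
      by (rule integrable_measure_pmf_bounded[where B="t powr p"]) auto
    show "(if t < real j then 1 else 0) * t powr p \<le> real j powr p" for j
      using assms p_gt1 by (auto intro: powr_mono2)
  qed (rule int_p)
  also have "\<dots> \<le> V" by (rule V_ge)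
  finally show ?thesis using assms by (simp add: field_simps)
qed

text \<open>With \<open>r = 2\<close> the Fuk--Nagaev term has exponent 1, and Markov's inequality
  bounds the tail term. The constant is \<open>34 = 7 * 4 + 6\<close>: from above
  \<open>1 + 2 * 3\<close> times \<open>2 powr p \<le> 4\<close>, from below \<open>2 * 3\<close>,
  both with \<open>exp 1 \<le> 3\<close>.\<close>

lemma sum_pmf_deviation:
  assumes "y > 0"
  shows "measure_pmf.prob (sum_pmf F k) {b. \<bar>real b - real k * m\<bar> > y} \<le> 34 * V * real k / y powr p"
proof -
  have e3: "exp 1 \<le> (3::real)" by (rule exp_le)
  have p4: "2 powr p \<le> (4::real)" using powr_mono[of p 2 "2::real"] p_le2 by simp
  have "measure_pmf.prob (sum_pmf F k) {b. \<bar>real b - real k * m\<bar> > y} \<le>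
    measure_pmf.prob (sum_pmf F k) ({b. real b > real k * m + y} \<union> {b. real b \<le> real k * m - y})"
    by (rule measure_pmf.finite_measure_mono) auto
  also have "\<dots> \<le> measure_pmf.prob (sum_pmf F k) {b. real b > real k * m + y} + measure_pmf.prob (sum_pmf F k) {b. real b \<le> real k * m - y}"
    by (rule measure_Un_le) auto
  also have "\<dots> \<le> (real k * Fbar F (y / 2) + exp 1 * (2 * real k * V / (y / 2) powr p) powr (2 / 2)) + 2 * exp 1 * real k * V / y powr p"
    by (intro add_mono sum_pmf_upper_tail sum_pmf_lower_tail) (use assms in auto)
  also have "\<dots> \<le> real k * (V / (y / 2) powr p) + 3 * (2 * real k * V / (y / 2) powr p) + 2 * 3 * real k * V / y powr p"
    using assms V_pos e3 Fbar_markov[of "y / 2"]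
    by (intro add_mono mult_mono divide_right_mono) (auto simp: powr_one)
  also have "\<dots> = (7 * 2 powr p + 6) * (real k * V / y powr p)"
    using assms by (simp add: powr_divide field_simps)
  also have "\<dots> \<le> 34 * (real k * V / y powr p)"
    using p4 V_pos by (intro mult_right_mono) auto
  finally show ?thesis by (simp add: algebra_simps)
qed

end

section \<open>The generation sizes\<close>

text \<open>The law of \<open>Z_n\<close> as a Markov chain on its own, without a probability space;
  \<open>prob_gw_Z\<close> identifies it with the law of the process.\<close>

fun generation_pmf :: "nat pmf \<Rightarrow> nat \<Rightarrow> nat pmf" where
  "generation_pmf F 0 = return_pmf 1"
| "generation_pmf F (Suc n) = bind_pmf (generation_pmf F n) (sum_pmf F)"

context moment_offspring
begin

lemma m_nonneg: "m \<ge> 0"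
  unfolding m_eq[symmetric] by (rule integral_nonneg_AE) auto

text \<open>Nonnegative integrals ask for no integrability in advance; their finite value yields the
  integrability of \<open>Z_n\<close> afterwards.\<close>

lemma nn_integral_sum_pmf:
  "(\<integral>\<^sup>+x. ennreal (real x) \<partial>sum_pmf F k) = ennreal (real k * m)"
proof (induction k)
  case (Suc k)
  have "(\<integral>\<^sup>+x. ennreal (real x) \<partial>sum_pmf F (Suc k)) =
      (\<integral>\<^sup>+a. (\<integral>\<^sup>+b. ennreal (real a) + ennreal (real b) \<partial>sum_pmf F k) \<partial>F)"
    by simp
  also have "\<dots> = (\<integral>\<^sup>+a. ennreal (real a) \<partial>F) + ennreal (real k * m)"
    by (simp add: nn_integral_add Suc del: ennreal_of_nat_eq_real_of_nat)
  also have "(\<integral>\<^sup>+a. ennreal (real a) \<partial>F) = ennreal m"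
    using nn_integral_eq_integral[OF integrable_real] by (simp add: m_eq)
  finally show ?case using m_nonneg by (simp add: ennreal_plus[symmetric] algebra_simps del: ennreal_plus)
qed auto

lemma nn_integral_generation_pmf:
  "(\<integral>\<^sup>+x. ennreal (real x) \<partial>generation_pmf F n) = ennreal (m ^ n)"
proof (induction n)
  case (Suc n)
  have "(\<integral>\<^sup>+x. ennreal (real x) \<partial>generation_pmf F (Suc n)) =
      (\<integral>\<^sup>+k. ennreal (real k * m) \<partial>generation_pmf F n)"
    by (simp add: nn_integral_sum_pmf)
  also have "\<dots> = (\<integral>\<^sup>+k. ennreal (real k) * ennreal m \<partial>generation_pmf F n)"
    by (simp add: ennreal_mult m_nonneg)
  also have "\<dots> = ennreal (m ^ n) * ennreal m"
    by (subst nn_integral_multc) (auto simp: Suc)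
  finally show ?case using m_nonneg by (simp add: ennreal_mult[symmetric] mult.commute)
qed auto

lemma integrable_generation_pmf: "integrable (generation_pmf F n) real"
  using nn_integral_generation_pmf[of n] by (intro integrableI_nonneg) auto

lemma expectation_generation_pmf: "measure_pmf.expectation (generation_pmf F n) real = m ^ n"
  using nn_integral_generation_pmf[of n] m_nonneg
  by (intro integral_eq_nn_integral[THEN trans]) auto

definition Wtail :: "nat \<Rightarrow> real \<Rightarrow> real" where
  "Wtail n x = measure_pmf.prob (generation_pmf F n) {k. real k > m ^ n * x}"

lemma Wtail_nonneg [simp]: "Wtail n x \<ge> 0" and Wtail_le_1 [simp]: "Wtail n x \<le> 1"
  by (simp_all add: Wtail_def)

lemma Wtail_antimono: "x \<le> y \<Longrightarrow> Wtail n y \<le> Wtail n x"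
  unfolding Wtail_def
  by (rule measure_pmf.finite_measure_mono)
    (auto intro: le_less_trans[OF mult_left_mono] simp: m_nonneg)

lemma Wtail_Suc:
  "Wtail (Suc n) x = measure_pmf.expectation (generation_pmf F n)
     (\<lambda>k. measure_pmf.prob (sum_pmf F k) {b. real b > m ^ Suc n * x})"
  by (simp add: Wtail_def measure_pmf_prob_bind)

lemma Wtail_0: "x \<ge> 1 \<Longrightarrow> Wtail 0 x = 0"
  by (simp add: Wtail_def)

lemma Wtail_1: "Wtail 1 x = Fbar F (m * x)"
proof -
  have "sum_pmf F 1 = F" by (simp add: map_pmf_def bind_return_pmf bind_return_pmf')
  then show ?thesis by (simp add: Wtail_def Fbar_def bind_return_pmf)
qed

end

section \<open>Dominatedly varying offspring tails\<close>

lemma power_powr_commute: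
  fixes z :: real
  assumes "z > 0" shows "(z ^ j) powr a = (z powr a) ^ j"
  by (induction j) (use assms in \<open>auto simp: powr_mult\<close>)

locale heavy_offspring =
  fixes F :: "nat pmf" and m D \<delta> c :: real
  assumes m_def: "m = offspring_mean F" and m_gt1: "m > 1"
    and dominated: "\<And>x. Fbar F (x / 2) \<le> D * Fbar F x"
    and delta_pos: "\<delta> > 0"
    and tail: "\<And>x y. x > 1 \<Longrightarrow> y > 1 \<Longrightarrow> Fbar F (x * y) \<le> c * Fbar F x / y powr (1 + \<delta>)"
begin

lemma D_ge_1: "D \<ge> 1"
  \<comment> \<open>At negative arguments both tails equal 1.\<close>
  using dominated[of "-1"] by (simp add: Fbar_neg)

lemma dominated_power: "Fbar F (x / 2 ^ k) \<le> D ^ k * Fbar F x"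
proof (induction k)
  case (Suc k)
  have "Fbar F (x / 2 ^ Suc k) \<le> D * Fbar F (x / 2 ^ k)"
    using dominated[of "x / 2 ^ k"] by (simp add: field_simps)
  also have "\<dots> \<le> D * (D ^ k * Fbar F x)"
    using Suc D_ge_1 by (intro mult_left_mono) auto
  finally show ?case by (simp add: algebra_simps)
qed auto

lemma Fbar_0_pos: "Fbar F 0 > 0"
proof (rule ccontr)
  assume "\<not> Fbar F 0 > 0"
  then have "measure_pmf.prob F {k. real k > 0} = 0"
    using Fbar_nonneg[of F 0] unfolding Fbar_def by linarith
  then have "AE k in F. k = 0"
    by (subst (asm) measure_pmf.prob_eq_0) auto
  then have "measure_pmf.expectation F real = measure_pmf.expectation F (\<lambda>_. 0)"
    by (intro integral_cong_AE) auto
  with m_gt1 show False by (simp add: m_def offspring_mean_def)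
qed

lemma Fbar_lt_1: "x < 1 \<Longrightarrow> x \<ge> 0 \<Longrightarrow> Fbar F x = Fbar F 0"
  unfolding Fbar_def by (rule arg_cong[where f="measure_pmf.prob F"]) auto

text \<open>Finitely many halvings bring \<open>x\<close> below 1, where the tail is
  \<open>Fbar F 0\<close>, positive because the mean is. Hence dominated variation forces unbounded
  support.\<close>

lemma Fbar_pos: "Fbar F x > 0"
proof (cases "x \<le> 0")
  case True
  then show ?thesis using Fbar_0_pos Fbar_antimono[of x 0 F] by linarith
next
  case False
  obtain k where "x < 2 ^ k" using real_arch_pow[of 2 x] by auto
  then have "x / 2 ^ k < 1" by simp
  then have "Fbar F 0 \<le> D ^ k * Fbar F x"
    using dominated_power[of x k] Fbar_lt_1[of "x / 2 ^ k"] False by simp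
  with Fbar_0_pos have "0 < D ^ k * Fbar F x" by linarith
  then show ?thesis using Fbar_nonneg[of F x] by (metis less_eq_real_def mult_zero_right)
qed

lemma Fbar_scale:
  assumes "a > 0"
  obtains C where "C \<ge> 1" "\<And>x. x \<ge> 0 \<Longrightarrow> Fbar F (a * x) \<le> C * Fbar F x"
proof -
  obtain k where k: "1 / a < 2 ^ k" using real_arch_pow[of 2 "1 / a"] by auto
  have "Fbar F (a * x) \<le> D ^ k * Fbar F x" if "x \<ge> 0" for x
  proof -
    have "1 / 2 ^ k \<le> a" using k assms by (simp add: field_simps)
    then have "x / 2 ^ k \<le> a * x" using mult_right_mono[of "1 / 2 ^ k" a x] that by simp
    then show ?thesis using Fbar_antimono[of "x / 2 ^ k" "a * x" F] dominated_power[of x k] by linarith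
  qed
  then show ?thesis using that[of "D ^ k"] D_ge_1 by auto
qed

text \<open>About \<open>log 2 x\<close> halvings bring \<open>x\<close> down to 1, each at the
  price of a factor \<open>D\<close>, and \<open>D\<close> to this power is \<open>x\<close> to the
  power \<open>log 2 D\<close>. High negative powers of \<open>x\<close> can thus be absorbed into
  the tail.\<close>

lemma Fbar_polynomial_lower:
  obtains \<kappa> A where "\<kappa> \<ge> 0" "A > 0" "\<And>x. x \<ge> 1 \<Longrightarrow> x powr (- \<kappa>) \<le> A * Fbar F x"
proof -
  define \<kappa> where "\<kappa> = log 2 D"
  have kap: "\<kappa> \<ge> 0" using D_ge_1 by (simp add: \<kappa>_def)
  have "x powr (- \<kappa>) \<le> (D / Fbar F 1) * Fbar F x" if x: "x \<ge> 1" for x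
  proof -
    define k where "k = nat \<lceil>log 2 x\<rceil>"
    have l0: "log 2 x \<ge> 0" using x by simp
    have k1: "log 2 x \<le> real k" and k2: "real k \<le> log 2 x + 1"
      using l0 by (simp_all add: k_def) 
    have "x = 2 powr log 2 x" using x by simp
    also have "\<dots> \<le> 2 powr real k" using k1 by simp
    finally have "x \<le> 2 ^ k" by (simp add: powr_realpow)
    then have "Fbar F 1 \<le> Fbar F (x / 2 ^ k)" by (intro Fbar_antimono) simp
    also have "\<dots> \<le> D ^ k * Fbar F x" by (rule dominated_power)
    also have "D ^ k = D powr real k" using D_ge_1 by (simp add: powr_realpow)
    also have "\<dots> \<le> D powr (log 2 x + 1)" using D_ge_1 k2 by (intro powr_mono) auto
    also have "\<dots> = D * x powr \<kappa>"
    proof -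
      have "D powr log 2 x = x powr log 2 D"
        using D_ge_1 x by (simp add: powr_def log_def)
      then show ?thesis using D_ge_1 by (simp add: powr_add \<kappa>_def)
    qed
    finally have "Fbar F 1 \<le> D * x powr \<kappa> * Fbar F x" by (simp add: mult_right_mono)
    then show ?thesis using x Fbar_pos[of 1] by (simp add: powr_minus field_simps)
  qed
  then show ?thesis using that[of \<kappa> "D / Fbar F 1"] kap D_ge_1 Fbar_pos[of 1] by auto
qed

text \<open>Staying strictly below \<open>1 + \<delta>\<close> makes the \<open>p\<close>-th moment
  finite.\<close>

definition p :: real where "p = 1 + min \<delta> 1 / 2"
definition V :: real where "V = measure_pmf.expectation F (\<lambda>j. real j powr p) + 1"

lemma p_gt_1: "p > 1" and p_le_2: "p \<le> 2" and p_less_delta: "p < 1 + \<delta>"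
  using delta_pos by (auto simp: p_def)

lemma tail_p:
  obtains C where "C \<ge> 1" "\<And>x y. x > 1 \<Longrightarrow> y \<ge> 1 \<Longrightarrow> Fbar F (x * y) \<le> C * Fbar F x / y powr p"
proof
  \<comment> \<open>The maximum with 1 covers \<open>y = 1\<close>, which the hypothesis on the tail
    leaves out.\<close>
  show "max c 1 \<ge> 1" by simp
  fix x y :: real assume "x > 1" "y \<ge> 1"
  then consider "y = 1" | "y > 1" by linarith
  then show "Fbar F (x * y) \<le> max c 1 * Fbar F x / y powr p"
  proof cases
    case 1
    then show ?thesis using Fbar_nonneg[of F x] using mult_right_mono[of 1 "max c 1" "Fbar F x"] by simp
  next
    case 2
    have "Fbar F (x * y) \<le> c * Fbar F x / y powr (1 + \<delta>)" using tail \<open>x > 1\<close> 2 by blast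
    also have "\<dots> \<le> max c 1 * Fbar F x / y powr (1 + \<delta>)"
      using 2 by (intro divide_right_mono mult_right_mono) auto
    also have "\<dots> \<le> max c 1 * Fbar F x / y powr p"
      using 2 p_less_delta by (intro divide_left_mono powr_mono mult_nonneg_nonneg mult_pos_pos) auto
    finally show ?thesis .
  qed
qed

lemma Fbar_polynomial_upper:
  obtains C where "C \<ge> 0" "\<And>t. t \<ge> 1 \<Longrightarrow> Fbar F t \<le> C * t powr (- (1 + \<delta>))"
proof
  let ?C = "max c 1 * 4 powr (1 + \<delta>)"
  show "?C \<ge> 0" by simp
  fix t :: real assume t: "t \<ge> 1"
  show "Fbar F t \<le> ?C * t powr (- (1 + \<delta>))"
  proof (cases "t \<le> 4")
    case True
    have "t powr (1 + \<delta>) \<le> 4 powr (1 + \<delta>)" using True t delta_pos by (intro powr_mono2) auto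
    then have "1 \<le> 4 powr (1 + \<delta>) * t powr (- (1 + \<delta>))" using t by (simp only: powr_minus) (simp add: field_simps)
    moreover have "1 * (4 powr (1 + \<delta>) * t powr (- (1 + \<delta>))) \<le> max c 1 * (4 powr (1 + \<delta>) * t powr (- (1 + \<delta>)))"
      by (intro mult_right_mono) auto
    ultimately show ?thesis using Fbar_le_1[of F t] unfolding mult_1_left mult.assoc by linarith
  next
    case False
    have "Fbar F (2 * (t / 2)) \<le> c * Fbar F 2 / (t / 2) powr (1 + \<delta>)"
      by (rule tail) (use False in auto)
    also have "\<dots> \<le> max c 1 * 1 / (t / 2) powr (1 + \<delta>)"
      by (intro divide_right_mono mult_mono) auto
    also have "\<dots> = max c 1 * 2 powr (1 + \<delta>) * t powr (- (1 + \<delta>))"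
      using t by (simp only: powr_divide powr_minus) (simp add: field_simps)
    also have "\<dots> \<le> ?C * t powr (- (1 + \<delta>))"
      using delta_pos by (intro mult_right_mono mult_left_mono powr_mono2) auto
    finally show ?thesis by simp
  qed
qed

text \<open>Dyadic decomposition: \<open>j\<^sup>p \<le> 2\<^bsup>(i+1)p\<^esup>\<close> for the \<open>i\<close> with \<open>2\<^bsup>i\<^esup> < j \<le> 2\<^bsup>i+1\<^esup>\<close>.\<close>

lemma integrable_p: "integrable F (\<lambda>j. real j powr p)"
proof -
  obtain C where C: "C \<ge> 0" "\<And>t. t \<ge> 1 \<Longrightarrow> Fbar F t \<le> C * t powr (- (1 + \<delta>))"
    using Fbar_polynomial_upper by blast
  let ?g = "\<lambda>i j. ennreal (2 powr (real (Suc i) * p)) * indicator {j. real j > 2 ^ i} j"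
  have le_suminf: "f i \<le> suminf f" for f :: "nat \<Rightarrow> ennreal" and i
    using sum_le_suminf[of f "{i}"] by simp
  have le: "ennreal (real j powr p) \<le> 1 + (\<Sum>i. ?g i j)" for j
  proof (cases "j \<le> 1")
    case True
    then have "real j powr p \<le> 1" by (cases "j = 0") (auto simp: le_Suc_eq)
    then have "ennreal (real j powr p) \<le> 1 + 0" by (simp add: ennreal_le_1)
    also have "\<dots> \<le> 1 + (\<Sum>i. ?g i j)" by (intro add_left_mono) auto
    finally show ?thesis .
  next
    case False
    have ex: "\<exists>i. real j \<le> 2 ^ i" using real_arch_pow[of 2 "real j"] by (auto intro: less_imp_le)
    define i where "i = (LEAST i. real j \<le> 2 ^ i)"
    have i: "real j \<le> 2 ^ i" unfolding i_def using ex by (rule LeastI_ex)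
    with False have "i \<noteq> 0" by (intro notI) simp
    then obtain i' where i': "i = Suc i'" by (cases i) auto
    have "\<not> real j \<le> 2 ^ i'" using not_less_Least[of i' "\<lambda>i. real j \<le> 2 ^ i"] i' by (simp add: i_def)
    then have mem: "real j > 2 ^ i'" by simp
    have "real j powr p \<le> (2 ^ i) powr p" using i p_gt_1 by (intro powr_mono2) auto
    also have "\<dots> = 2 powr (real (Suc i') * p)" by (simp add: i' powr_realpow[symmetric] powr_powr del: power_Suc)
    finally have "ennreal (real j powr p) \<le> ?g i' j" using mem by (simp add: ennreal_leI)
    also have "\<dots> \<le> (\<Sum>i. ?g i j)" by (rule le_suminf)
    also have "\<dots> \<le> 1 + (\<Sum>i. ?g i j)" by (simp add: add_increasing)
    finally show ?thesis .
  qed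
  \<comment> \<open>The ratio of the geometric series: block \<open>i\<close> carries weight
    \<open>2^((i + 1) p)\<close> and has probability of order at most
    \<open>2^(- i (1 + \<delta>))\<close>.\<close>
  let ?\<rho> = "2 powr (p - (1 + \<delta>)) :: real"
  have rho: "?\<rho> < 1" using p_less_delta by (intro powr_less_one) auto
  have term_le: "2 powr (real (Suc i) * p) * Fbar F (2 ^ i) \<le> 2 powr p * C * ?\<rho> ^ i" for i
  proof -
    have "2 powr (real (Suc i) * p) * Fbar F (2 ^ i) \<le> 2 powr (real (Suc i) * p) * (C * (2 ^ i) powr (- (1 + \<delta>)))"
      by (intro mult_left_mono C) auto
    also have "\<dots> = 2 powr p * C * (2 powr (real i * p) * 2 powr (real i * (- (1 + \<delta>))))"
      by (simp add: powr_realpow[symmetric] powr_powr powr_add[symmetric] algebra_simps)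
    also have "2 powr (real i * p) * 2 powr (real i * (- (1 + \<delta>))) = ?\<rho> ^ i"
      by (simp add: powr_add[symmetric] powr_power algebra_simps)
    finally show ?thesis .
  qed
  have sm: "summable (\<lambda>i. 2 powr p * C * ?\<rho> ^ i)"
    by (intro summable_mult summable_geometric) (use rho in simp)
  have "(\<integral>\<^sup>+j. ennreal (real j powr p) \<partial>F) \<le> (\<integral>\<^sup>+j. 1 + (\<Sum>i. ?g i j) \<partial>F)"
    by (intro nn_integral_mono le)
  also have "\<dots> = 1 + (\<Sum>i. \<integral>\<^sup>+j. ?g i j \<partial>F)"
    by (simp add: nn_integral_add nn_integral_suminf)
  also have "(\<lambda>i. \<integral>\<^sup>+j. ?g i j \<partial>F) = (\<lambda>i. ennreal (2 powr (real (Suc i) * p) * Fbar F (2 ^ i)))"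
    by (subst nn_integral_cmult_indicator)
      (auto simp: measure_pmf.emeasure_eq_measure Fbar_def ennreal_mult)
  also have "1 + (\<Sum>i. ennreal (2 powr (real (Suc i) * p) * Fbar F (2 ^ i))) \<le> 1 + (\<Sum>i. ennreal (2 powr p * C * ?\<rho> ^ i))"
    by (intro add_left_mono suminf_le ennreal_leI term_le) auto
  also have "\<dots> = 1 + ennreal (\<Sum>i. 2 powr p * C * ?\<rho> ^ i)"
    using sm C by (subst suminf_ennreal2) auto
  also have "\<dots> < \<infinity>" by (simp add: ennreal_add_less_top)
  finally show ?thesis by (intro integrableI_nonneg) auto
qed

sublocale moment_offspring F m p V
proof
  have "measure_pmf.expectation F (\<lambda>j. real j powr p) \<ge> 0" by (rule integral_nonneg_AE) auto
  then show "V > 0" unfolding V_def by linarith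
qed (use p_gt_1 p_le_2 integrable_p in \<open>auto simp: m_def V_def\<close>)

text \<open>The ratio \<open>q\<close> of the levels below is chosen so that \<open>(m q)\<^sup>p = m / q\<close>.\<close>

definition q :: real where "q = m powr ((1 - p) / (1 + p))"

lemma q_pos: "q > 0" and q_less_1: "q < 1"
proof -
  show "q > 0" using m_gt1 by (simp add: q_def)
  have "(1 - p) / (1 + p) < 0" using p_gt_1 by (intro divide_neg_pos) auto
  then show "q < 1" using m_gt1 by (simp add: q_def powr_less_one)
qed

lemma mq_powr: "(m * q) powr p = m / q"
proof -
  have "p + (1 - p) / (1 + p) * p = 1 - (1 - p) / (1 + p)"
    using p_gt_1 by (simp add: field_simps)
  then show ?thesis
    using m_gt1 p_gt_1 by (simp add: q_def powr_mult powr_powr powr_add[symmetric] powr_diff)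
qed

text \<open>The permitted deviations \<open>(m * q) ^ j\<close> grow with \<open>j\<close>, so that
  \<open>tail_p\<close> can be applied with this factor.\<close>

lemma mq_gt_1: "m * q > 1"
proof (rule ccontr)
  assume "\<not> ?thesis"
  then have "(m * q) powr p \<le> 1" using m_gt1 q_pos p_gt_1 by (intro powr_le1) auto
  moreover have "m / q > 1" using m_gt1 q_less_1 q_pos by (simp add: field_simps)
  ultimately show False by (simp add: mq_powr)
qed

lemma mq_power_powr: "((m * q) ^ j) powr p = m ^ j / q ^ j"
  using m_gt1 q_pos by (subst power_powr_commute) (auto simp: mq_powr power_divide)

end

section \<open>Comparison of consecutive generations\<close>

context moment_offspring
begin

text \<open>Conditioning on \<open>Z_n\<close>: populations above \<open>m ^ n * x\<close> are
  charged 1, which gives the tail of \<open>W_n\<close>, and all others are charged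
  \<open>g\<close>.\<close>

lemma Wtail_Suc_upper:
  assumes int: "integrable (generation_pmf F n) g" and g: "\<And>k. g k \<ge> 0"
    and le: "\<And>k. real k \<le> m ^ n * x \<Longrightarrow> measure_pmf.prob (sum_pmf F k) {b. real b > m ^ Suc n * y} \<le> g k"
  shows "Wtail (Suc n) y \<le> Wtail n x + measure_pmf.expectation (generation_pmf F n) g"
proof -
  let ?I = "\<lambda>k. if real k > m ^ n * x then 1 else 0 :: real"
  have intI: "integrable (generation_pmf F n) ?I"
    by (rule integrable_measure_pmf_bounded[where B=1]) auto
  have "Wtail (Suc n) y \<le> measure_pmf.expectation (generation_pmf F n) (\<lambda>k. ?I k + g k)"
    unfolding Wtail_Suc
  proof (rule integral_mono)
    fix k
    have "measure_pmf.prob (sum_pmf F k) {b. real b > m ^ Suc n * y} \<le> 1" by simp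
    then show "measure_pmf.prob (sum_pmf F k) {b. real b > m ^ Suc n * y} \<le> ?I k + g k"
      using le[of k] g[of k] by (cases "real k \<le> m ^ n * x") (auto simp del: measure_pmf.prob_le_1)
  qed (use int intI in auto)
  also have "\<dots> = Wtail n x + measure_pmf.expectation (generation_pmf F n) g"
    using int intI by (simp add: expectation_indicator_pmf Wtail_def)
  finally show ?thesis .
qed

text \<open>Here \<open>g\<close> may be negative: in \<open>Wtail_asymptotic_fixed\<close> it
  serves the small populations and does not exceed 0 on the large ones, where \<open>a\<close> takes
  over.\<close>

lemma Wtail_Suc_lower:
  assumes int: "integrable (generation_pmf F n) g"
    and le: "\<And>k. g k + (if real k > m ^ n * x then a else 0) \<le> measure_pmf.prob (sum_pmf F k) {b. real b > m ^ Suc n * y}"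
  shows "measure_pmf.expectation (generation_pmf F n) g + a * Wtail n x \<le> Wtail (Suc n) y"
proof -
  let ?I = "\<lambda>k. if real k > m ^ n * x then 1 else 0 :: real"
  have intI: "integrable (generation_pmf F n) ?I"
    by (rule integrable_measure_pmf_bounded[where B=1]) auto
  have "measure_pmf.expectation (generation_pmf F n) g + a * Wtail n x
     = measure_pmf.expectation (generation_pmf F n) (\<lambda>k. g k + a * ?I k)"
    using int intI by (simp add: expectation_indicator_pmf Wtail_def)
  also have "\<dots> \<le> Wtail (Suc n) y"
    unfolding Wtail_Suc
  proof (rule integral_mono)
    fix k
    show "g k + a * ?I k \<le> measure_pmf.prob (sum_pmf F k) {b. real b > m ^ Suc n * y}"
      using le[of k] by (auto split: if_splits)
  qed (use int intI in auto)
  finally show ?thesis .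
qed

lemma sum_pmf_stays_above:
  assumes "k > 0" "\<epsilon> > 0" "m > 0" "t \<le> real k * m * (1 - \<epsilon>)"
  shows "1 - 34 * V * real k powr (1 - p) / (m * \<epsilon> / 2) powr p
    \<le> measure_pmf.prob (sum_pmf F k) {b. real b > t}"
proof -
  \<comment> \<open>Half the available gap, since \<open>sum_pmf_deviation\<close> controls a strict
    excess.\<close>
  let ?y = "real k * (m * \<epsilon> / 2)"
  have y: "?y > 0" using assms by simp
  have "measure_pmf.prob (sum_pmf F k) (UNIV - {b. real b > t})
      \<le> measure_pmf.prob (sum_pmf F k) {b. \<bar>real b - real k * m\<bar> > ?y}"
  proof (rule measure_pmf.finite_measure_mono)
    show "UNIV - {b. real b > t} \<subseteq> {b. \<bar>real b - real k * m\<bar> > ?y}"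
    proof
      fix b assume "b \<in> UNIV - {b. real b > t}"
      then have "real b \<le> real k * m - 2 * ?y" using assms by (simp add: algebra_simps)
      then show "b \<in> {b. \<bar>real b - real k * m\<bar> > ?y}" using y by simp
    qed
  qed simp
  also have "\<dots> \<le> 34 * V * real k / ?y powr p" by (rule sum_pmf_deviation) fact
  also have "\<dots> = 34 * V * real k powr (1 - p) / (m * \<epsilon> / 2) powr p"
    using assms by (simp only: powr_mult powr_diff) simp
  finally show ?thesis
    using measure_pmf.prob_compl[of "{b. real b > t}" "sum_pmf F k"] by simp
qed

end

context heavy_offspring
begin

text \<open>The increasing levels \<open>1 - q\<^sup>n / 2\<close> make the bound telescope: \<open>W\<^bsub>j+1\<^esub>\<close> can exceed level
  \<open>j + 1\<close> with \<open>W\<^bsub>j\<^esub>\<close> below level \<open>j\<close> only by a deviation of order \<open>(m q)\<^sup>j x\<close> in one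
  generation.\<close>

lemma Wtail_upper_step:
  obtains C where "C \<ge> 0"
    "\<And>j x. x > 1 \<Longrightarrow> Wtail (Suc j) (x * (1 - q ^ Suc j / 2)) \<le> Wtail j (x * (1 - q ^ j / 2)) + C * q ^ j * Fbar F x"
proof -
  obtain \<kappa> A where A: "\<kappa> \<ge> 0" "A > 0" "\<And>x. x \<ge> 1 \<Longrightarrow> x powr (- \<kappa>) \<le> A * Fbar F x"
    using Fbar_polynomial_lower by blast
  \<comment> \<open>Large enough for \<open>x powr ((1 - p) * \<rho>)\<close> to be at most
    \<open>x powr (- \<kappa>)\<close>, hence at most \<open>A * Fbar F x\<close>, and at least 1 so
    that \<open>(q ^ j) powr \<rho>\<close> stays below \<open>q ^ j\<close>.\<close>
  define \<rho> where "\<rho> = max 1 (\<kappa> / (p - 1))"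
  have rho1: "\<rho> \<ge> 1" by (simp add: \<rho>_def)
  have "\<kappa> / (p - 1) \<le> \<rho>" by (simp add: \<rho>_def)
  then have rhok: "\<kappa> \<le> (p - 1) * \<rho>" using p_gt_1 by (simp add: field_simps)
  \<comment> \<open>In terms of population size the gap between the levels,
    \<open>m ^ Suc j * x * (q ^ j - q ^ Suc j) / 2\<close>, equals
    \<open>b * (m * q) ^ j * x\<close>.\<close>
  define b where "b = (1 - q) * m / 2"
  have b: "b > 0" using q_less_1 m_gt1 by (simp add: b_def)
  \<comment> \<open>Truncation at \<open>y / r\<close> with \<open>r = 2 * \<rho>\<close> gives the
    second Fuk--Nagaev term the exponent \<open>\<rho>\<close>.\<close>
  define h where "h = b / (2 * \<rho>)"
  have h: "h > 0" using b rho1 by (simp add: h_def)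
  obtain C1 where C1: "C1 \<ge> 1" "\<And>x. x \<ge> 0 \<Longrightarrow> Fbar F (h * x) \<le> C1 * Fbar F x"
    using Fbar_scale[OF h] by blast
  obtain C2 where C2: "C2 \<ge> 1" "\<And>x y. x > 1 \<Longrightarrow> y \<ge> 1 \<Longrightarrow> Fbar F (x * y) \<le> C2 * Fbar F x / y powr p"
    using tail_p by blast
  define K where "K = 2 * V / h powr p"
  have K: "K > 0" using V_pos h by (simp add: K_def)
  define C where "C = C1 * C2 + exp 1 * K powr \<rho> * A"
  have C: "C \<ge> 0" using C1 C2 A by (simp add: C_def)
  moreover have "Wtail (Suc j) (x * (1 - q ^ Suc j / 2)) \<le> Wtail j (x * (1 - q ^ j / 2)) + C * q ^ j * Fbar F x"
    if x: "x > 1" for j x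
  proof -
    define w where "w = (m * q) ^ j"
    have w: "w \<ge> 1" unfolding w_def using mq_gt_1 by (intro one_le_power) simp
    have wp: "w powr p = m ^ j / q ^ j" unfolding w_def by (rule mq_power_powr)
    have qj: "q ^ j > 0" "q ^ j \<le> 1" using q_pos q_less_1 by (auto intro: power_le_one)
    have mj: "m ^ j > 0" using m_gt1 by simp
    define y where "y = b * (w * x)"
    have y: "y > 0" using b w x by (simp add: y_def)
    have yr: "y / (2 * \<rho>) = h * (w * x)" by (simp add: y_def h_def)
    \<comment> \<open>\<open>B1\<close> is charged per individual and \<open>B2\<close> per
      generation; the mean population \<open>m ^ j\<close> cancels the denominator in
      \<open>B1\<close>.\<close>
    define B1 where "B1 = C1 * C2 * Fbar F x * (q ^ j / m ^ j)"
    define B2 where "B2 = exp 1 * K powr \<rho> * A * q ^ j * Fbar F x"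
    have B: "B1 \<ge> 0" "B2 \<ge> 0" using C1 C2 A qj mj by (auto simp: B1_def B2_def)
    have B1: "Fbar F (y / (2 * \<rho>)) \<le> B1"
    proof -
      have "Fbar F (h * (w * x)) \<le> C1 * Fbar F (x * w)" using C1(2)[of "w * x"] w x by (simp add: mult.commute)
      also have "\<dots> \<le> C1 * (C2 * Fbar F x / w powr p)" using C1 C2(2)[of x w] w x by (intro mult_left_mono) auto
      also have "\<dots> = B1" by (simp add: wp B1_def)
      finally show ?thesis by (simp add: yr)
    qed
    have B2: "exp 1 * (2 * real k * V / (y / (2 * \<rho>)) powr p) powr (2 * \<rho> / 2) \<le> B2"
      if k: "real k \<le> m ^ j * x" for k
    proof -
      have "2 * real k * V / (y / (2 * \<rho>)) powr p \<le> 2 * (m ^ j * x) * V / (y / (2 * \<rho>)) powr p"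
        using k V_pos by (intro divide_right_mono mult_right_mono mult_left_mono) auto
      also have "\<dots> = K * q ^ j * x powr (1 - p)"
        unfolding yr using h w x mj qj m_gt1 by (simp add: powr_mult wp K_def powr_diff field_simps)
      finally have *: "2 * real k * V / (y / (2 * \<rho>)) powr p \<le> K * q ^ j * x powr (1 - p)" .
      have "(2 * real k * V / (y / (2 * \<rho>)) powr p) powr \<rho> \<le> (K * q ^ j * x powr (1 - p)) powr \<rho>"
        using V_pos rho1 by (intro powr_mono2 *) auto
      also have "\<dots> = K powr \<rho> * (q ^ j) powr \<rho> * x powr ((1 - p) * \<rho>)"
        using K qj by (simp add: powr_mult powr_powr)
      also have "\<dots> \<le> K powr \<rho> * q ^ j * (A * Fbar F x)"
      proof (intro mult_mono mult_left_mono)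
        show "(q ^ j) powr \<rho> \<le> q ^ j" using powr_mono'[of 1 \<rho> "q ^ j"] qj rho1 by simp
        have "x powr ((1 - p) * \<rho>) \<le> x powr (- \<kappa>)" using x rhok by (intro powr_mono) (auto simp: algebra_simps)
        also have "\<dots> \<le> A * Fbar F x" using A(3) x by simp
        finally show "x powr ((1 - p) * \<rho>) \<le> A * Fbar F x" .
      qed (use qj in auto)
      finally show ?thesis by (simp add: B2_def mult_ac)
    qed
    have "Wtail (Suc j) (x * (1 - q ^ Suc j / 2)) \<le> Wtail j (x * (1 - q ^ j / 2)) + measure_pmf.expectation (generation_pmf F j) (\<lambda>k. real k * B1 + B2)"
    proof (rule Wtail_Suc_upper)
      show "integrable (generation_pmf F j) (\<lambda>k. real k * B1 + B2)"
        using integrable_generation_pmf by simp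
      show "real k * B1 + B2 \<ge> 0" for k using B by simp
      fix k assume k: "real k \<le> m ^ j * (x * (1 - q ^ j / 2))"
      have kx: "real k \<le> m ^ j * x"
      proof -
        have "m ^ j * (x * (1 - q ^ j / 2)) \<le> m ^ j * (x * 1)"
          using mj x qj by (intro mult_left_mono) auto
        then show ?thesis using k by simp
      qed
      have "real k * m + y \<le> m ^ j * (x * (1 - q ^ j / 2)) * m + y"
        using k m_gt1 by (intro add_right_mono mult_right_mono) auto
      also have "\<dots> = m ^ Suc j * (x * (1 - q ^ Suc j / 2))"
        by (simp add: y_def b_def w_def power_mult_distrib field_simps)
      finally have "measure_pmf.prob (sum_pmf F k) {b. real b > m ^ Suc j * (x * (1 - q ^ Suc j / 2))} \<le> measure_pmf.prob (sum_pmf F k) {b. real b > real k * m + y}"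
        by (intro measure_pmf.finite_measure_mono) auto
      also have "\<dots> \<le> real k * Fbar F (y / (2 * \<rho>)) + exp 1 * (2 * real k * V / (y / (2 * \<rho>)) powr p) powr (2 * \<rho> / 2)"
        by (rule sum_pmf_upper_tail) (use y rho1 in auto)
      also have "\<dots> \<le> real k * B1 + B2"
        using B1 B2[OF kx] by (intro add_mono mult_left_mono) auto
      finally show "measure_pmf.prob (sum_pmf F k) {b. real b > m ^ Suc j * (x * (1 - q ^ Suc j / 2))} \<le> real k * B1 + B2" .
    qed
    also have "measure_pmf.expectation (generation_pmf F j) (\<lambda>k. real k * B1 + B2) = m ^ j * B1 + B2"
      using integrable_generation_pmf by (simp add: expectation_generation_pmf)
    also have "\<dots> = C * q ^ j * Fbar F x"
      using m_gt1 by (simp add: B1_def B2_def C_def field_simps)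
    finally show ?thesis by simp
  qed
  ultimately show ?thesis using that by blast
qed

text \<open>All levels of the step stay below \<open>x\<close>, so the last one can be replaced by
  \<open>x\<close>, and the errors sum to a geometric series.\<close>

lemma Wtail_upper:
  obtains C where "C \<ge> 0"
    "\<And>N n x. N \<le> n \<Longrightarrow> x > 1 \<Longrightarrow> Wtail n x \<le> Wtail N (x * (1 - q ^ N / 2)) + C * q ^ N * Fbar F x"
proof -
  obtain C where C: "C \<ge> 0"
    "\<And>j x. x > 1 \<Longrightarrow> Wtail (Suc j) (x * (1 - q ^ Suc j / 2)) \<le> Wtail j (x * (1 - q ^ j / 2)) + C * q ^ j * Fbar F x"
    using Wtail_upper_step by blast
  have "Wtail n x \<le> Wtail N (x * (1 - q ^ N / 2)) + C / (1 - q) * q ^ N * Fbar F x"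
    if "N \<le> n" "x > 1" for N n x
  proof -
    have "Wtail n (x * (1 - q ^ n / 2)) \<le> Wtail N (x * (1 - q ^ N / 2)) + C / (1 - q) * (q ^ N - q ^ n) * Fbar F x"
      using \<open>N \<le> n\<close>
    proof (induction n rule: dec_induct)
      case (step n)
      have "C / (1 - q) * (q ^ N - q ^ n) * Fbar F x + C * q ^ n * Fbar F x = C / (1 - q) * (q ^ N - q ^ Suc n) * Fbar F x"
        using q_less_1 by (simp add: field_simps)
      with step.IH C(2)[OF \<open>x > 1\<close>, of n] show ?case by linarith
    qed simp
    also have "\<dots> \<le> Wtail N (x * (1 - q ^ N / 2)) + C / (1 - q) * q ^ N * Fbar F x"
      using C(1) q_less_1 q_pos by (intro add_left_mono mult_right_mono mult_left_mono) auto
    finally have *: "Wtail n (x * (1 - q ^ n / 2)) \<le> Wtail N (x * (1 - q ^ N / 2)) + C / (1 - q) * q ^ N * Fbar F x" .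
    have "x * (1 - q ^ n / 2) \<le> x * 1" using q_pos \<open>x > 1\<close> by (intro mult_left_mono) auto
    then have "Wtail n x \<le> Wtail n (x * (1 - q ^ n / 2))" by (intro Wtail_antimono) simp
    with * show ?thesis by linarith
  qed
  then show ?thesis using that[of "C / (1 - q)"] C q_less_1 by auto
qed

text \<open>A population above \<open>m ^ n * x\<close> is so large that the next one falls short
  with small probability. The loss multiplies the tail of \<open>W_n\<close>, so it is not measured
  against \<open>Fbar F x\<close>.\<close>

lemma Wtail_lower_step:
  assumes x: "x > 0"
  shows "(1 - 34 * V / (m * (1 - q) / 4) powr p * x powr (1 - p) * q ^ n) * Wtail n (x * (1 + q ^ n))
    \<le> Wtail (Suc n) (x * (1 + q ^ Suc n))"
proof -
  let ?a = "1 - 34 * V / (m * (1 - q) / 4) powr p * x powr (1 - p) * q ^ n"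
  have qn: "q ^ n > 0" "q ^ n \<le> 1" using q_pos q_less_1 by (auto intro: power_le_one)
  have mn: "m ^ n > 0" using m_gt1 by simp
  have "measure_pmf.expectation (generation_pmf F n) (\<lambda>k. 0) + ?a * Wtail n (x * (1 + q ^ n))
    \<le> Wtail (Suc n) (x * (1 + q ^ Suc n))"
  proof (rule Wtail_Suc_lower)
    fix k
    show "0 + (if real k > m ^ n * (x * (1 + q ^ n)) then ?a else 0)
      \<le> measure_pmf.prob (sum_pmf F k) {b. real b > m ^ Suc n * (x * (1 + q ^ Suc n))}"
    proof (cases "real k > m ^ n * (x * (1 + q ^ n))")
      case True
      have kx: "m ^ n * x \<le> real k"
      proof -
        have "m ^ n * (x * 1) \<le> m ^ n * (x * (1 + q ^ n))"
          using mn x qn by (intro mult_left_mono) auto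
        then show ?thesis using True by simp
      qed
      have mx: "m ^ n * x > 0" using mn x by simp
      have k0: "k > 0" using kx mx by (cases k) auto
      \<comment> \<open>The level falls by \<open>2 * \<epsilon>\<close> in units of
        \<open>x\<close>; since \<open>1 + q ^ n \<le> 2\<close>, a relative loss of
        \<open>\<epsilon>\<close> does not go below the new level.\<close>
      define \<epsilon> where "\<epsilon> = (1 - q) * q ^ n / 2"
      have eps: "\<epsilon> > 0" using q_less_1 qn by (simp add: \<epsilon>_def)
      have "1 + q ^ Suc n \<le> (1 + q ^ n) * (1 - \<epsilon>)"
      proof -
        have "(1 + q ^ n) * (1 - \<epsilon>) - (1 + q ^ Suc n) = \<epsilon> * (1 - q ^ n)"
          by (simp add: \<epsilon>_def field_simps)
        moreover have "\<epsilon> * (1 - q ^ n) \<ge> 0" using eps qn by simp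
        ultimately show ?thesis by linarith
      qed
      then have "m ^ Suc n * (x * (1 + q ^ Suc n)) \<le> m ^ Suc n * (x * ((1 + q ^ n) * (1 - \<epsilon>)))"
        using m_gt1 x by (intro mult_left_mono) auto
      also have "\<dots> = (m ^ n * (x * (1 + q ^ n))) * (m * (1 - \<epsilon>))" by (simp add: algebra_simps)
      also have "\<dots> \<le> real k * (m * (1 - \<epsilon>))"
      proof -
        have "(1 - q) * q ^ n \<le> 1 * 1" using q_pos q_less_1 qn by (intro mult_mono) auto
        then show ?thesis using True m_gt1 by (intro mult_right_mono) (auto simp: \<epsilon>_def)
      qed
      finally have "1 - 34 * V * real k powr (1 - p) / (m * \<epsilon> / 2) powr p
        \<le> measure_pmf.prob (sum_pmf F k) {b. real b > m ^ Suc n * (x * (1 + q ^ Suc n))}"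
        using k0 eps m_gt1 by (intro sum_pmf_stays_above) (auto simp: mult.assoc)
      moreover have "34 * V * real k powr (1 - p) / (m * \<epsilon> / 2) powr p \<le> 34 * V / (m * (1 - q) / 4) powr p * x powr (1 - p) * q ^ n"
      proof -
        have "m * \<epsilon> / 2 = (m * (1 - q) / 4) * ((m * q) ^ n / m ^ n)"
          using m_gt1 by (simp add: \<epsilon>_def power_mult_distrib)
        also have "\<dots> powr p = (m * (1 - q) / 4) powr p * ((m ^ n / q ^ n) / (m ^ n) powr p)"
          using m_gt1 q_pos q_less_1 by (subst powr_mult) (auto simp: powr_divide mq_power_powr)
        finally have scale: "(m * \<epsilon> / 2) powr p = (m * (1 - q) / 4) powr p * ((m ^ n / q ^ n) / (m ^ n) powr p)" .
        \<comment> \<open>After this replacement all powers of \<open>m ^ n\<close> cancel, and only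
          \<open>q ^ n\<close> is left.\<close>
        have "real k powr (1 - p) \<le> (m ^ n * x) powr (1 - p)"
          using kx mx p_gt_1 by (intro powr_mono2') auto
        then have "34 * V * real k powr (1 - p) / (m * \<epsilon> / 2) powr p \<le> 34 * V * (m ^ n * x) powr (1 - p) / (m * \<epsilon> / 2) powr p"
          using V_pos by (intro divide_right_mono mult_left_mono) auto
        also have "\<dots> = 34 * V / (m * (1 - q) / 4) powr p * x powr (1 - p) * q ^ n"
          unfolding scale using m_gt1 qn x mn by (simp add: powr_mult powr_diff field_simps)
        finally show ?thesis .
      qed
      ultimately show ?thesis using True by simp
    qed simp
  qed simp
  then show ?thesis by simp
qed

text \<open>The factors \<open>1 - c q^i\<close> of the steps multiply to at least 1 minus the sum
  of the \<open>c q^i\<close>, which is bounded uniformly in \<open>N\<close> and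
  \<open>n\<close>.\<close>

lemma Wtail_lower:
  obtains C where "C \<ge> 0"
    "\<And>N n x. N \<le> n \<Longrightarrow> x > 0 \<Longrightarrow> Wtail N (x * (1 + q ^ N)) * (1 - C * x powr (1 - p)) \<le> Wtail n x"
proof -
  define C where "C = 34 * V / (m * (1 - q) / 4) powr p"
  have C: "C \<ge> 0" using V_pos by (simp add: C_def)
  have "Wtail N (x * (1 + q ^ N)) * (1 - C / (1 - q) * x powr (1 - p)) \<le> Wtail n x"
    if "N \<le> n" "x > 0" for N n x
  proof (cases "C / (1 - q) * x powr (1 - p) \<le> 1")
    case False
    then show ?thesis
      by (intro order_trans[OF mult_nonneg_nonpos Wtail_nonneg]) auto
  next
    case True
    let ?c = "C * x powr (1 - p)"
    have c0: "?c \<ge> 0" using C by simp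
    have c1: "?c / (1 - q) \<le> 1" using True by simp
    then have c2: "?c \<le> 1" using q_less_1 q_pos by (simp add: field_simps)
    have "Wtail N (x * (1 + q ^ N)) * (1 - ?c / (1 - q) * (q ^ N - q ^ n)) \<le> Wtail n (x * (1 + q ^ n))"
      using \<open>N \<le> n\<close>
    proof (induction n rule: dec_induct)
      case (step n)
      have qn: "q ^ n > 0" "q ^ n \<le> 1" "q ^ N \<le> 1" "q ^ n \<le> q ^ N"
        using q_pos q_less_1 step by (auto intro: power_le_one power_decreasing)
      define s where "s = ?c / (1 - q) * (q ^ N - q ^ n)"
      have s0: "s \<ge> 0" unfolding s_def using c0 q_less_1 qn by (intro mult_nonneg_nonneg) auto
      have d0: "?c * q ^ n \<ge> 0" "?c * q ^ n \<le> 1"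
        using c0 c2 qn by (auto intro: mult_le_one)
      have "Wtail N (x * (1 + q ^ N)) * (1 - ?c / (1 - q) * (q ^ N - q ^ Suc n))
         = Wtail N (x * (1 + q ^ N)) * (1 - s - ?c * q ^ n)"
        using q_less_1 by (simp add: s_def field_simps)
      also have "\<dots> \<le> Wtail N (x * (1 + q ^ N)) * ((1 - s) * (1 - ?c * q ^ n))"
        using mult_nonneg_nonneg[OF s0 d0(1)] by (intro mult_left_mono) (auto simp: algebra_simps)
      also have "\<dots> \<le> (1 - ?c * q ^ n) * Wtail n (x * (1 + q ^ n))"
        using mult_left_mono[OF step.IH, of "1 - ?c * q ^ n"] d0 by (simp add: s_def algebra_simps)
      also have "\<dots> \<le> Wtail (Suc n) (x * (1 + q ^ Suc n))"
        using Wtail_lower_step[OF \<open>x > 0\<close>, of n] by (simp add: C_def)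
      finally show ?case .
    qed simp
    moreover have "Wtail N (x * (1 + q ^ N)) * (1 - ?c / (1 - q)) \<le> Wtail N (x * (1 + q ^ N)) * (1 - ?c / (1 - q) * (q ^ N - q ^ n))"
    proof -
      have "q ^ N - q ^ n \<le> 1" using q_pos q_less_1 power_le_one[of q N] zero_less_power[of q n] by linarith
      then have "?c / (1 - q) * (q ^ N - q ^ n) \<le> ?c / (1 - q) * 1"
        using c0 q_less_1 by (intro mult_left_mono) auto
      then show ?thesis by (intro mult_left_mono) auto
    qed
    moreover have "Wtail n (x * (1 + q ^ n)) \<le> Wtail n x"
      using q_pos \<open>x > 0\<close> by (intro Wtail_antimono) simp
    ultimately show ?thesis by simp
  qed
  then show ?thesis using that[of "C / (1 - q)"] C q_less_1 by auto
qed

lemma one_minus_p_tendsto: "((\<lambda>x. C * x powr (1 - p)) \<longlongrightarrow> 0) at_top"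
  using tendsto_mult[OF tendsto_const[of C] tendsto_neg_powr[OF _ filterlim_ident, of "1 - p"]] p_gt_1
  by simp

text \<open>Comparison with generation 0: \<open>W_0 = 1\<close>, and the level
  \<open>x * (1 - 1 / 2)\<close> is at least 1 precisely for \<open>x \<ge> 2\<close>, so that only
  the error term remains.\<close>

lemma Wtail_le:
  obtains C where "C \<ge> 0" "\<And>n x. x \<ge> 2 \<Longrightarrow> Wtail n x \<le> C * Fbar F x"
proof -
  obtain C where C: "C \<ge> 0"
    "\<And>N n x. N \<le> n \<Longrightarrow> x > 1 \<Longrightarrow> Wtail n x \<le> Wtail N (x * (1 - q ^ N / 2)) + C * q ^ N * Fbar F x"
    using Wtail_upper by blast
  have "Wtail n x \<le> C * Fbar F x" if "x \<ge> 2" for n x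
    using C(2)[of 0 n x] that by (simp add: Wtail_0)
  then show ?thesis using that C by blast
qed

text \<open>From below the comparison is with generation 1, whose tail is
  \<open>Fbar F (m * x)\<close>; the tail of \<open>W_0\<close> vanishes for
  \<open>x \<ge> 1\<close>, hence \<open>n \<ge> 1\<close>.\<close>

lemma Wtail_bounds:
  "\<exists>c1>0. \<exists>c2. \<forall>x. \<forall>n\<ge>1. c1 * Fbar F x \<le> Wtail n x \<and> Wtail n x \<le> c2 * Fbar F x"
proof -
  obtain C where C: "C \<ge> 0" "\<And>n x. x \<ge> 2 \<Longrightarrow> Wtail n x \<le> C * Fbar F x"
    using Wtail_le by blast
  obtain C' where C': "C' \<ge> 0"
    "\<And>N n x. N \<le> n \<Longrightarrow> x > 0 \<Longrightarrow> Wtail N (x * (1 + q ^ N)) * (1 - C' * x powr (1 - p)) \<le> Wtail n x"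
    using Wtail_lower by blast
  have "eventually (\<lambda>x. C' * x powr (1 - p) < 1 / 2) at_top"
    by (rule order_tendstoD(2)[OF one_minus_p_tendsto]) simp
  then obtain X where X: "\<And>x. x \<ge> X \<Longrightarrow> C' * x powr (1 - p) < 1 / 2"
    by (auto simp: eventually_at_top_linorder)
  define X0 where "X0 = max X 1"
  obtain C2 where C2: "C2 \<ge> 1" "\<And>x. x \<ge> 0 \<Longrightarrow> Fbar F (1 / (m * (1 + q)) * x) \<le> C2 * Fbar F x"
    using Fbar_scale[of "1 / (m * (1 + q))"] m_gt1 q_pos by (auto simp: add_pos_pos)
  \<comment> \<open>The value at \<open>X0\<close> settles \<open>x < X0\<close> through
    \<open>c1 * Fbar F x \<le> c1 \<le> Wtail n X0 \<le> Wtail n x\<close>.\<close>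
  define c1 where "c1 = Fbar F X0 / (2 * C2)"
  have c1: "c1 > 0" using Fbar_pos C2 by (simp add: c1_def)
  have low: "Fbar F x \<le> (2 * C2) * Wtail n x" if "x \<ge> X0" "n \<ge> 1" for x n
  proof -
    have x: "x > 0" "x \<ge> X" using that by (auto simp: X0_def)
    have "Fbar F x = Fbar F (1 / (m * (1 + q)) * (m * (1 + q) * x))" using m_gt1 q_pos by simp
    also have "\<dots> \<le> C2 * Fbar F (m * (1 + q) * x)"
      using m_gt1 q_pos x by (intro C2(2) mult_nonneg_nonneg) auto
    also have "\<dots> = C2 * Wtail 1 (x * (1 + q ^ 1))" by (simp only: Wtail_1) (simp add: algebra_simps)
    also have "\<dots> \<le> C2 * (2 * Wtail n x)"
    proof (intro mult_left_mono)
      have "Wtail 1 (x * (1 + q ^ 1)) * (1 / 2) \<le> Wtail 1 (x * (1 + q ^ 1)) * (1 - C' * x powr (1 - p))"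
        using X[OF x(2)] by (intro mult_left_mono) auto
      also have "\<dots> \<le> Wtail n x" by (rule C'(2)) (use that x in auto)
      finally show "Wtail 1 (x * (1 + q ^ 1)) \<le> 2 * Wtail n x" by simp
    qed (use C2 in auto)
    finally show ?thesis by simp
  qed
  \<comment> \<open>The summand \<open>1 / Fbar F 2\<close> makes the upper bound at least 1 for
    \<open>x < 2\<close>.\<close>
  have "c1 * Fbar F x \<le> Wtail n x \<and> Wtail n x \<le> (C + 1 / Fbar F 2) * Fbar F x" if n: "n \<ge> 1" for x n
  proof
    show "c1 * Fbar F x \<le> Wtail n x"
    proof (cases "x \<ge> X0")
      case True
      have "c1 * Fbar F x \<le> 1 / (2 * C2) * Fbar F x" unfolding c1_def
        using C2 by (intro mult_right_mono divide_right_mono) auto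
      also have "\<dots> \<le> Wtail n x" using low[OF True n] C2 by (simp add: field_simps)
      finally show ?thesis .
    next
      case False
      have "c1 * Fbar F x \<le> c1 * 1" using c1 by (intro mult_left_mono) auto
      also have "c1 * 1 \<le> Wtail n X0" using low[OF order_refl n] C2 by (simp add: c1_def field_simps)
      also have "\<dots> \<le> Wtail n x" using False by (intro Wtail_antimono) simp
      finally show ?thesis .
    qed
    show "Wtail n x \<le> (C + 1 / Fbar F 2) * Fbar F x"
    proof (cases "x \<ge> 2")
      case True
      have "Wtail n x \<le> C * Fbar F x" by (rule C(2)) (use True in auto)
      also have "\<dots> \<le> (C + 1 / Fbar F 2) * Fbar F x" by (intro mult_right_mono) auto
      finally show ?thesis .
    next
      case False
      then have "Fbar F 2 \<le> Fbar F x" by (intro Fbar_antimono) simp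
      then have "1 \<le> 1 / Fbar F 2 * Fbar F x" using Fbar_pos[of 2] by (simp add: field_simps)
      also have "\<dots> \<le> (C + 1 / Fbar F 2) * Fbar F x" using C(1) by (intro mult_right_mono) auto
      finally show ?thesis using Wtail_le_1[of n x] by linarith
    qed
  qed
  then show ?thesis using c1 by blast
qed

end

section \<open>Intermediate regularly varying offspring tails\<close>

lemma eventually_at_top_scale:
  fixes P :: "real \<Rightarrow> bool"
  assumes "eventually P at_top" "c > 0"
  shows "eventually (\<lambda>x. P (x * c)) at_top"
proof -
  have "filterlim (\<lambda>x::real. x * c) at_top at_top"
    using assms(2) by (intro filterlim_at_top_mult_tendsto_pos[OF tendsto_const] filterlim_ident) auto
  then show ?thesis using assms(1) by (simp add: filterlim_iff)
qed

context heavy_offspring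
begin

lemma Fbar_tendsto_0: "(Fbar F \<longlongrightarrow> 0) at_top"
proof -
  obtain C where C: "C \<ge> 0" "\<And>t. t \<ge> 1 \<Longrightarrow> Fbar F t \<le> C * t powr (- (1 + \<delta>))"
    using Fbar_polynomial_upper by blast
  have "((\<lambda>t. C * t powr (- (1 + \<delta>))) \<longlongrightarrow> C * 0) at_top"
    using delta_pos by (intro tendsto_mult tendsto_const tendsto_neg_powr filterlim_ident) auto
  then have "((\<lambda>t. C * t powr (- (1 + \<delta>))) \<longlongrightarrow> 0) at_top" by simp
  moreover have "eventually (\<lambda>t. Fbar F t \<le> C * t powr (- (1 + \<delta>))) at_top"
    using C(2) by (intro eventually_at_top_linorderI[of 1])
  ultimately show ?thesis
    by (intro tendsto_sandwich[of "\<lambda>_. 0" "Fbar F" at_top "\<lambda>t. C * t powr (- (1 + \<delta>))" 0]) simp_all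
qed

text \<open>Linearity in \<open>k\<close> allows the populations above a cut-off to be neglected by
  integrability of \<open>Z_N\<close> alone.\<close>

lemma sum_pmf_linear_bound:
  assumes eta: "0 < \<eta>" "\<eta> < 1"
  obtains C where "C \<ge> 1"
    "\<And>k y. y \<ge> 1 \<Longrightarrow> real k * m \<le> y * (1 - \<eta>) \<Longrightarrow>
       measure_pmf.prob (sum_pmf F k) {b. real b > y} \<le> C * real k * Fbar F y"
proof -
  obtain \<kappa> A where A: "\<kappa> \<ge> 0" "A > 0" "\<And>x. x \<ge> 1 \<Longrightarrow> x powr (- \<kappa>) \<le> A * Fbar F x"
    using Fbar_polynomial_lower by blast
  define \<rho> where "\<rho> = max 1 (\<kappa> / (p - 1))"
  have rho1: "\<rho> \<ge> 1" by (simp add: \<rho>_def)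
  have "\<kappa> / (p - 1) \<le> \<rho>" by (simp add: \<rho>_def)
  then have rhok: "\<kappa> \<le> (p - 1) * \<rho>" using p_gt_1 by (simp add: field_simps)
  define h where "h = \<eta> / (2 * \<rho>)"
  have h: "h > 0" using eta rho1 by (simp add: h_def)
  obtain C1 where C1: "C1 \<ge> 1" "\<And>x. x \<ge> 0 \<Longrightarrow> Fbar F (h * x) \<le> C1 * Fbar F x"
    using Fbar_scale[OF h] by blast
  define L where "L = 2 * V / h powr p"
  have L: "L > 0" using V_pos h by (simp add: L_def)
  define C where "C = C1 + exp 1 * L powr \<rho> * A"
  have C: "C \<ge> 1" using C1 A by (simp add: C_def add_increasing2)
  moreover have "measure_pmf.prob (sum_pmf F k) {b. real b > y} \<le> C * real k * Fbar F y"
    if y: "y \<ge> 1" and ky: "real k * m \<le> y * (1 - \<eta>)" for k y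
  proof (cases "k = 0")
    case True
    then show ?thesis using y by (simp add: indicator_def)
  next
    case False
    have "real k * 1 \<le> real k * m" using m_gt1 by (intro mult_left_mono) auto
    also have "\<dots> \<le> y * (1 - \<eta>)" by fact
    also have "\<dots> \<le> y * 1" using eta y by (intro mult_left_mono) auto
    finally have kley: "real k \<le> y" by simp
    have yr: "(\<eta> * y) / (2 * \<rho>) = h * y" by (simp add: h_def)
    have "measure_pmf.prob (sum_pmf F k) {b. real b > y} \<le> measure_pmf.prob (sum_pmf F k) {b. real b > real k * m + \<eta> * y}"
      using ky by (intro measure_pmf.finite_measure_mono) (auto simp: algebra_simps)
    also have "\<dots> \<le> real k * Fbar F (\<eta> * y / (2 * \<rho>)) + exp 1 * (2 * real k * V / (\<eta> * y / (2 * \<rho>)) powr p) powr (2 * \<rho> / 2)"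
      by (rule sum_pmf_upper_tail) (use y eta rho1 in auto)
    also have "\<dots> \<le> real k * (C1 * Fbar F y) + exp 1 * (L powr \<rho> * real k * (A * Fbar F y))"
    proof (intro add_mono mult_left_mono)
      show "Fbar F (\<eta> * y / (2 * \<rho>)) \<le> C1 * Fbar F y" unfolding yr using y by (intro C1(2)) simp
      have "2 * real k * V / (\<eta> * y / (2 * \<rho>)) powr p = L * real k * y powr (- p)"
        unfolding yr using h y by (simp add: powr_mult L_def powr_minus field_simps)
      then have "(2 * real k * V / (\<eta> * y / (2 * \<rho>)) powr p) powr (2 * \<rho> / 2) = L powr \<rho> * real k powr \<rho> * y powr (- p * \<rho>)"
        using L y by (simp add: powr_mult powr_powr)
      \<comment> \<open>One factor \<open>k\<close> is kept for linearity; the other powers are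
        traded for powers of \<open>y\<close>, using \<open>k \<le> y\<close>.\<close>
      also have "real k powr \<rho> = real k * real k powr (\<rho> - 1)"
        using False powr_add[of "real k" 1 "\<rho> - 1"] by simp
      also have "L powr \<rho> * (real k * real k powr (\<rho> - 1)) * y powr (- p * \<rho>)
          \<le> L powr \<rho> * (real k * y powr (\<rho> - 1)) * y powr (- p * \<rho>)"
        using kley rho1 by (intro mult_right_mono mult_left_mono powr_mono2) auto
      also have "\<dots> = L powr \<rho> * real k * y powr (\<rho> - 1 - p * \<rho>)"
        by (simp add: powr_add[symmetric])
      also have "\<dots> \<le> L powr \<rho> * real k * y powr (- \<kappa>)"
        using y rhok by (intro mult_left_mono powr_mono) (auto simp: algebra_simps)
      also have "\<dots> \<le> L powr \<rho> * real k * (A * Fbar F y)"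
        using y by (intro mult_left_mono A(3)) auto
      finally show "(2 * real k * V / (\<eta> * y / (2 * \<rho>)) powr p) powr (2 * \<rho> / 2) \<le> L powr \<rho> * real k * (A * Fbar F y)" .
    qed auto
    also have "\<dots> = C * real k * Fbar F y" by (simp add: C_def algebra_simps)
    finally show ?thesis .
  qed
  ultimately show ?thesis using that by blast
qed

section \<open>Partial sums of the limiting series\<close>

definition G :: "nat \<Rightarrow> real \<Rightarrow> real" where
  "G n x = (\<Sum>i<n. m ^ i * Fbar F (m ^ (i + 1) * x))"

text \<open>The ratio of the geometric bound on the terms of \<open>G\<close>: the weight
  \<open>m ^ i\<close> against the decay \<open>(m ^ i) powr (- p)\<close>.\<close>

definition \<theta> :: real where "\<theta> = m powr (1 - p)"

lemma theta_pos: "\<theta> > 0" and theta_less_1: "\<theta> < 1"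
  using m_gt1 p_gt_1 by (auto simp: \<theta>_def powr_less_one)

lemma G_term_bound:
  obtains C where "C \<ge> 1" "\<And>i x. x > 1 \<Longrightarrow> m ^ i * Fbar F (m ^ (i + 1) * x) \<le> C * \<theta> ^ i * Fbar F x"
proof -
  obtain C where C: "C \<ge> 1" "\<And>x y. x > 1 \<Longrightarrow> y \<ge> 1 \<Longrightarrow> Fbar F (x * y) \<le> C * Fbar F x / y powr p"
    using tail_p by blast
  have "m ^ i * Fbar F (m ^ (i + 1) * x) \<le> C * \<theta> ^ i * Fbar F x" if "x > 1" for i x
  proof -
    have "m ^ i * x \<le> m ^ (i + 1) * x" using m_gt1 that by (intro mult_right_mono) (auto intro: mult_left_mono)
    then have "m ^ i * Fbar F (m ^ (i + 1) * x) \<le> m ^ i * Fbar F (x * m ^ i)"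
      using m_gt1 by (intro mult_left_mono Fbar_antimono) (auto simp: mult.commute)
    also have "\<dots> \<le> m ^ i * (C * Fbar F x / (m ^ i) powr p)"
      using m_gt1 that by (intro mult_left_mono C(2)) (auto intro: one_le_power)
    also have "\<dots> = C * \<theta> ^ i * Fbar F x"
      using m_gt1 by (simp add: \<theta>_def power_powr_commute powr_diff power_divide)
    finally show ?thesis .
  qed
  then show ?thesis using C(1) that by blast
qed

lemma G_mono: "N \<le> n \<Longrightarrow> G N x \<le> G n x"
  unfolding G_def using m_gt1 by (intro sum_mono2) auto

lemma G_tail_bound:
  obtains C where "C \<ge> 1" "\<And>N n x. N \<le> n \<Longrightarrow> x > 1 \<Longrightarrow> G n x \<le> G N x + C * \<theta> ^ N * Fbar F x"
proof -
  obtain C where C: "C \<ge> 1" "\<And>i x. x > 1 \<Longrightarrow> m ^ i * Fbar F (m ^ (i + 1) * x) \<le> C * \<theta> ^ i * Fbar F x"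
    using G_term_bound by blast
  have "G n x \<le> G N x + C / (1 - \<theta>) * \<theta> ^ N * Fbar F x" if "N \<le> n" "x > 1" for N n x
  proof -
    have "G n x \<le> G N x + C / (1 - \<theta>) * (\<theta> ^ N - \<theta> ^ n) * Fbar F x"
      using \<open>N \<le> n\<close>
    proof (induction n rule: dec_induct)
      case (step n)
      have "C / (1 - \<theta>) * (\<theta> ^ N - \<theta> ^ n) * Fbar F x + C * \<theta> ^ n * Fbar F x = C / (1 - \<theta>) * (\<theta> ^ N - \<theta> ^ Suc n) * Fbar F x"
        using theta_less_1 by (simp add: field_simps)
      moreover have "G (Suc n) x = G n x + m ^ n * Fbar F (m ^ (n + 1) * x)" by (simp add: G_def)
      ultimately show ?case using step.IH C(2)[OF \<open>x > 1\<close>, of n] by linarith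
    qed simp
    also have "\<dots> \<le> G N x + C / (1 - \<theta>) * \<theta> ^ N * Fbar F x"
      using C(1) theta_less_1 theta_pos by (intro add_left_mono mult_right_mono mult_left_mono) auto
    finally show ?thesis .
  qed
  moreover have "C / (1 - \<theta>) \<ge> 1" using C(1) theta_less_1 theta_pos by (simp add: field_simps)
  ultimately show ?thesis using that by blast
qed

lemma G_le:
  obtains C where "C \<ge> 1" "\<And>n x. x > 1 \<Longrightarrow> G n x \<le> C * Fbar F x"
proof -
  obtain C where C: "C \<ge> 1" "\<And>N n x. N \<le> n \<Longrightarrow> x > 1 \<Longrightarrow> G n x \<le> G N x + C * \<theta> ^ N * Fbar F x"
    using G_tail_bound by blast
  have "G n x \<le> C * Fbar F x" if "x > 1" for n x
    using C(2)[of 0 n x] that by (simp add: G_def)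
  with C(1) that show ?thesis by blast
qed

end

locale irv_offspring = heavy_offspring +
  assumes irv: "intermediate_regularly_varying F"
begin

text \<open>Intermediate regular variation looks to the right only, so it is applied at the left end
  \<open>x * (1 - \<eta>)\<close> of the window; dominated variation brings the resulting error back
  to \<open>Fbar F x\<close>.\<close>

lemma Fbar_window:
  assumes "e > 0"
  obtains \<eta> where "0 < \<eta>" "\<eta> \<le> 1 / 2"
    "eventually (\<lambda>x. Fbar F (x * (1 - \<eta>)) - Fbar F (x * (1 + \<eta>)) \<le> e * Fbar F x) at_top"
proof -
  define e' where "e' = e / D"
  have e': "e' > 0" using assms D_ge_1 by (simp add: e'_def)
  have "eventually (\<lambda>\<epsilon>. ereal (1 - e') < Liminf at_top (\<lambda>x. ereal (Fbar F (x * (1 + \<epsilon>)) / Fbar F x))) (at_right 0)"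
    by (rule order_tendstoD(1)[OF irv[unfolded intermediate_regularly_varying_def]]) (use e' in simp)
  then have "eventually (\<lambda>\<epsilon>. ereal (1 - e') < Liminf at_top (\<lambda>x. ereal (Fbar F (x * (1 + \<epsilon>)) / Fbar F x)) \<and> \<epsilon> > 0) (at_right 0)"
    using eventually_at_right_less[of "0::real"] by (rule eventually_conj)
  then obtain \<epsilon> where eps: "ereal (1 - e') < Liminf at_top (\<lambda>x. ereal (Fbar F (x * (1 + \<epsilon>)) / Fbar F x))" "\<epsilon> > 0"
    using eventually_happens[of _ "at_right (0::real)"] by auto
  from less_LiminfD[OF eps(1)] have ev: "eventually (\<lambda>z. 1 - e' < Fbar F (z * (1 + \<epsilon>)) / Fbar F z) at_top"
    by simp
  \<comment> \<open>The second bound amounts to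
    \<open>1 + \<eta> \<le> (1 - \<eta>) * (1 + \<epsilon>)\<close>; the first gives
    \<open>x / 2 \<le> x * (1 - \<eta>)\<close>.\<close>
  define \<eta> where "\<eta> = min (1 / 2) (\<epsilon> / (2 + \<epsilon>))"
  have eta: "\<eta> > 0" "\<eta> \<le> 1 / 2"
    using eps(2) unfolding \<eta>_def by (simp, intro min.cobounded1)
  have "\<eta> \<le> \<epsilon> / (2 + \<epsilon>)" by (simp add: \<eta>_def)
  then have "\<eta> * (2 + \<epsilon>) \<le> \<epsilon>" using eps(2) by (simp add: field_simps)
  then have etaeps: "1 + \<eta> \<le> (1 - \<eta>) * (1 + \<epsilon>)" by (simp add: algebra_simps)
  have "eventually (\<lambda>x. 1 - e' < Fbar F (x * (1 - \<eta>) * (1 + \<epsilon>)) / Fbar F (x * (1 - \<eta>))) at_top"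
    by (rule eventually_at_top_scale[OF ev]) (use eta in simp)
  then have "eventually (\<lambda>x. Fbar F (x * (1 - \<eta>)) - Fbar F (x * (1 + \<eta>)) \<le> e * Fbar F x) at_top"
    using eventually_ge_at_top[of 0]
  proof eventually_elim
    case (elim x)
    have "Fbar F (x * (1 - \<eta>) * (1 + \<epsilon>)) \<le> Fbar F (x * (1 + \<eta>))"
      using etaeps elim by (intro Fbar_antimono) (auto simp: mult.assoc intro: mult_left_mono)
    moreover have "(1 - e') * Fbar F (x * (1 - \<eta>)) < Fbar F (x * (1 - \<eta>) * (1 + \<epsilon>))"
      using elim Fbar_pos[of "x * (1 - \<eta>)"] by (simp add: field_simps)
    ultimately have "Fbar F (x * (1 - \<eta>)) - Fbar F (x * (1 + \<eta>)) \<le> e' * Fbar F (x * (1 - \<eta>))"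
      by (simp add: algebra_simps)
    also have "\<dots> \<le> e' * Fbar F (x / 2)"
      using eta elim e' mult_left_mono[of "1 / 2" "1 - \<eta>" x] by (intro mult_left_mono Fbar_antimono) auto
    also have "\<dots> \<le> e' * (D * Fbar F x)" using e' by (intro mult_left_mono dominated) auto
    also have "\<dots> = e * Fbar F x" using D_ge_1 by (simp add: e'_def)
    finally show ?case .
  qed
  with eta that show ?thesis by blast
qed

text \<open>Since \<open>m ^ (i + 1) * x \<ge> x\<close>, one threshold serves all terms of all
  \<open>G N\<close>, whence the uniformity in \<open>N\<close>.\<close>

lemma G_window:
  assumes "e > 0"
  obtains \<eta> where "0 < \<eta>" "\<eta> \<le> 1 / 2"
    "eventually (\<lambda>x. \<forall>N. G N (x * (1 - \<eta>)) - G N (x * (1 + \<eta>)) \<le> e * Fbar F x) at_top"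
proof -
  obtain C where C: "C \<ge> 1" "\<And>n x. x > 1 \<Longrightarrow> G n x \<le> C * Fbar F x"
    using G_le by blast
  define e' where "e' = e / C"
  have e': "e' > 0" using assms C by (simp add: e'_def)
  obtain \<eta> where eta: "0 < \<eta>" "\<eta> \<le> 1 / 2"
    "eventually (\<lambda>x. Fbar F (x * (1 - \<eta>)) - Fbar F (x * (1 + \<eta>)) \<le> e' * Fbar F x) at_top"
    using Fbar_window[OF e'] by blast
  then obtain X where X: "\<And>x. x \<ge> X \<Longrightarrow> Fbar F (x * (1 - \<eta>)) - Fbar F (x * (1 + \<eta>)) \<le> e' * Fbar F x"
    by (auto simp: eventually_at_top_linorder)
  have "eventually (\<lambda>x. \<forall>N. G N (x * (1 - \<eta>)) - G N (x * (1 + \<eta>)) \<le> e * Fbar F x) at_top"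
    using eventually_ge_at_top[of X] eventually_gt_at_top[of 1]
  proof eventually_elim
    case (elim x)
    show ?case
    proof
      fix N
      have "G N (x * (1 - \<eta>)) - G N (x * (1 + \<eta>)) =
        (\<Sum>i<N. m ^ i * (Fbar F ((m ^ (i + 1) * x) * (1 - \<eta>)) - Fbar F ((m ^ (i + 1) * x) * (1 + \<eta>))))"
        by (simp add: G_def sum_subtractf right_diff_distrib mult.assoc)
      also have "\<dots> \<le> (\<Sum>i<N. m ^ i * (e' * Fbar F (m ^ (i + 1) * x)))"
      proof (intro sum_mono mult_left_mono X)
        fix i
        have "1 * x \<le> m ^ (i + 1) * x" using m_gt1 elim by (intro mult_right_mono one_le_power) auto
        with elim show "X \<le> m ^ (i + 1) * x" by linarith
      qed (use m_gt1 in auto)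
      also have "\<dots> = e' * G N x" by (simp add: G_def sum_distrib_left algebra_simps)
      also have "\<dots> \<le> e' * (C * Fbar F x)" using e' elim by (intro mult_left_mono C(2)) auto
      also have "\<dots> = e * Fbar F x" using C by (simp add: e'_def)
      finally show "G N (x * (1 - \<eta>)) - G N (x * (1 + \<eta>)) \<le> e * Fbar F x" .
    qed
  qed
  with eta that show ?thesis by blast
qed

text \<open>The principle of one big jump: in the induction, two parts that are both of order
  \<open>x\<close> cost a product of two tails, negligible because \<open>Fbar F x\<close> tends to
  0.\<close>

lemma sum_pmf_asymptotic:
  assumes "e > 0"
  shows "eventually (\<lambda>x. \<bar>measure_pmf.prob (sum_pmf F k) {b. real b > x} - real k * Fbar F x\<bar> \<le> e * Fbar F x) at_top"
  using assms
proof (induction k arbitrary: e)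
  case 0
  show ?case using eventually_ge_at_top[of 0] by eventually_elim (use 0 in \<open>auto simp: indicator_def\<close>)
next
  case (Suc k)
  \<comment> \<open>The upper estimate loses \<open>e1 * (real k + 3 + e1)\<close>, the lower one
    \<open>2 * e1\<close>; both are at most \<open>e\<close>.\<close>
  define e1 where "e1 = min 1 (e / (real k + 4))"
  have e1: "e1 > 0" "e1 \<le> 1" using Suc.prems by (auto simp: e1_def)
  have "e1 \<le> e / (real k + 4)" by (simp add: e1_def)
  then have e1e: "e1 * (real k + 4) \<le> e" by (simp add: field_simps)
  let ?Q = "\<lambda>x. measure_pmf.prob (sum_pmf F k) {b. real b > x}"
  obtain \<eta> where eta: "0 < \<eta>" "\<eta> \<le> 1 / 2"
    "eventually (\<lambda>x. Fbar F (x * (1 - \<eta>)) - Fbar F (x * (1 + \<eta>)) \<le> e1 * Fbar F x) at_top"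
    using Fbar_window[OF e1(1)] by blast
  obtain C where C: "C \<ge> 1" "\<And>x. x \<ge> 0 \<Longrightarrow> Fbar F (\<eta> * x) \<le> C * Fbar F x"
    using Fbar_scale[OF eta(1)] by blast
  have IH: "eventually (\<lambda>x. \<bar>?Q x - real k * Fbar F x\<bar> \<le> e1 * Fbar F x) at_top"
    by (rule Suc.IH) fact
  \<comment> \<open>\<open>C\<^sup>2\<close> pays for two tails taken at \<open>\<eta> * x\<close>,
    and \<open>real k + 1\<close> for the tail of the sum of \<open>k\<close> variables.\<close>
  have small: "eventually (\<lambda>x. Fbar F x < e1 / ((real k + 1) * C\<^sup>2)) at_top"
    by (rule order_tendstoD(2)[OF Fbar_tendsto_0]) (use e1 C in auto)
  have IH1: "eventually (\<lambda>x. \<bar>?Q (x * (1 - \<eta>)) - real k * Fbar F (x * (1 - \<eta>))\<bar> \<le> e1 * Fbar F (x * (1 - \<eta>))) at_top"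
    by (rule eventually_at_top_scale[OF IH]) (use eta in simp)
  have IH2: "eventually (\<lambda>x. \<bar>?Q (x * \<eta>) - real k * Fbar F (x * \<eta>)\<bar> \<le> e1 * Fbar F (x * \<eta>)) at_top"
    by (rule eventually_at_top_scale[OF IH eta(1)])
  show ?case using eta(3) IH IH1 IH2 small eventually_ge_at_top[of 0]
  proof eventually_elim
    case (elim x)
    let ?B = "Fbar F x"
    have B: "?B > 0" by (rule Fbar_pos)
    have small': "(real k + 1) * C\<^sup>2 * ?B \<le> e1"
    proof -
      have "(real k + 1) * C\<^sup>2 > 0" using C by simp
      then show ?thesis using elim(5) by (simp add: field_simps)
    qed
    have "Fbar F (x * (1 + \<eta>)) \<le> ?B"
      using elim eta by (intro Fbar_antimono) (simp add: algebra_simps)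
    with elim(1) have b1: "Fbar F (x * (1 - \<eta>)) \<le> (1 + e1) * ?B" by (simp add: algebra_simps)
    have "?Q (x * (1 - \<eta>)) \<le> (real k + e1) * Fbar F (x * (1 - \<eta>))" using elim(3) by (simp add: algebra_simps abs_le_iff)
    also have "\<dots> \<le> (real k + e1) * ((1 + e1) * ?B)" using b1 e1 by (intro mult_left_mono) auto
    finally have b2: "?Q (x * (1 - \<eta>)) \<le> (real k + e1) * (1 + e1) * ?B" by simp
    have "?Q (\<eta> * x) \<le> (real k + e1) * Fbar F (\<eta> * x)" using elim(4) by (simp add: algebra_simps abs_le_iff)
    also have "\<dots> \<le> (real k + 1) * (C * ?B)" using e1 C elim by (intro mult_mono C(2)) auto
    finally have "Fbar F (\<eta> * x) * ?Q (\<eta> * x) \<le> (C * ?B) * ((real k + 1) * (C * ?B))"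
      using C elim by (intro mult_mono C(2)) auto
    also have "\<dots> = ((real k + 1) * C\<^sup>2 * ?B) * ?B" by (simp add: power2_eq_square algebra_simps)
    also have "\<dots> \<le> e1 * ?B" using small' B by (intro mult_right_mono) auto
    finally have b3: "Fbar F (\<eta> * x) * ?Q (\<eta> * x) \<le> e1 * ?B" .
    have "measure_pmf.prob (sum_pmf F (Suc k)) {b. real b > x} \<le> (1 + e1) * ?B + (real k + e1) * (1 + e1) * ?B + e1 * ?B"
      using sum_pmf_Suc_window(1)[of F k x \<eta>] b1 b2 b3 by linarith
    also have "\<dots> = (real k + 1 + e1 * (real k + 3 + e1)) * ?B" by (simp add: algebra_simps)
    also have "\<dots> \<le> (real k + 1 + e) * ?B"
    proof (intro mult_right_mono)
      have "e1 * (real k + 3 + e1) \<le> e1 * (real k + 4)" using e1 by (intro mult_left_mono) auto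
      then show "real k + 1 + e1 * (real k + 3 + e1) \<le> real k + 1 + e" using e1e by linarith
    qed simp
    finally have up: "measure_pmf.prob (sum_pmf F (Suc k)) {b. real b > x} \<le> (real k + 1 + e) * ?B" .
    have "(real k + 1) * 1 * ?B \<le> (real k + 1) * C\<^sup>2 * ?B"
      using C B by (intro mult_right_mono mult_left_mono) (auto intro: one_le_power)
    then have kb: "(real k + 1) * ?B \<le> e1" using small' unfolding mult_1_right by (rule order_trans)
    have "?Q x \<le> (real k + e1) * ?B" using elim(2) by (simp add: algebra_simps abs_le_iff)
    also have "\<dots> \<le> (real k + 1) * ?B" using e1 B by (intro mult_right_mono) auto
    finally have q: "?Q x \<le> e1" using kb by simp
    have "?B * ?Q x \<le> ?B * e1" using q B by (intro mult_left_mono) auto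
    moreover have "?Q x \<ge> (real k - e1) * ?B" using elim(2) by (simp add: algebra_simps abs_le_iff)
    ultimately have "measure_pmf.prob (sum_pmf F (Suc k)) {b. real b > x} \<ge> ?B + (real k - e1) * ?B - ?B * e1"
      using sum_pmf_Suc_window(2)[of F x k] by linarith
    also have "?B + (real k - e1) * ?B - ?B * e1 = (real k + 1 - 2 * e1) * ?B" by (simp add: algebra_simps)
    finally have "(real k + 1 - 2 * e1) * ?B \<le> measure_pmf.prob (sum_pmf F (Suc k)) {b. real b > x}" .
    moreover have "(real k + 1 - e) * ?B \<le> (real k + 1 - 2 * e1) * ?B"
    proof (intro mult_right_mono)
      have "e1 * 2 \<le> e1 * (real k + 4)" using e1 by (intro mult_left_mono) auto
      then show "real k + 1 - e \<le> real k + 1 - 2 * e1" using e1e by linarith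
    qed simp
    ultimately show ?case using up by (simp add: algebra_simps abs_le_iff)
  qed
qed

end

context moment_offspring
begin

lemma generation_pmf_tail_expectation:
  assumes "d > 0"
  obtains K :: nat where "measure_pmf.expectation (generation_pmf F n) (\<lambda>k. if k > K then real k else 0) < d"
proof -
  have "(\<lambda>K. measure_pmf.expectation (generation_pmf F n) (\<lambda>k. if k > K then real k else 0))
      \<longlonglongrightarrow> measure_pmf.expectation (generation_pmf F n) (\<lambda>k. 0)"
  proof (rule integral_dominated_convergence[where w=real])
    show "AE k in generation_pmf F n. (\<lambda>K. if k > K then real k else 0) \<longlonglongrightarrow> 0"
    proof (rule AE_I2)
      fix k :: nat
      have "eventually (\<lambda>K. (if k > K then real k else 0) = 0) sequentially"
        using eventually_ge_at_top[of k] by eventually_elim auto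
      then show "(\<lambda>K. if k > K then real k else 0) \<longlonglongrightarrow> 0" by (rule tendsto_eventually)
    qed
  qed (use integrable_generation_pmf in auto)
  then have "(\<lambda>K. measure_pmf.expectation (generation_pmf F n) (\<lambda>k. if k > K then real k else 0)) \<longlonglongrightarrow> 0"
    by simp
  from order_tendstoD(2)[OF this assms] show ?thesis
    using that by (auto simp: eventually_sequentially)
qed

end

context irv_offspring
begin

lemma G_Suc: "G (Suc n) x = G n x + m ^ n * Fbar F (m ^ Suc n * x)"
  by (simp add: G_def)

text \<open>Moves the asymptotics from \<open>x\<close> to both ends of a window. The index set
  \<open>I\<close> is a singleton while one generation is considered, and \<open>UNIV\<close> once
  uniformity is available; \<open>\<eta>\<close> does not depend on it.\<close>

lemma Wtail_window:
  assumes "e > 0"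
  obtains \<eta> where "0 < \<eta>" "\<eta> \<le> 1 / 2"
    "\<And>I. (\<And>e. e > 0 \<Longrightarrow> eventually (\<lambda>x. \<forall>N\<in>I. \<bar>Wtail N x - G N x\<bar> \<le> e * Fbar F x) at_top) \<Longrightarrow>
       eventually (\<lambda>x. \<forall>N\<in>I. Wtail N (x * (1 - \<eta>)) \<le> G N x + e * Fbar F x
         \<and> G N x - e * Fbar F x \<le> Wtail N (x * (1 + \<eta>))) at_top"
proof -
  \<comment> \<open>One \<open>d\<close> for the oscillation of \<open>G\<close>, and
    \<open>d * D\<close> for the error at \<open>x * (1 - \<eta>)\<close>, where the tail may be
    \<open>D\<close> times as large.\<close>
  define d where "d = e / (D + 1)"
  have d: "d > 0" using assms D_ge_1 by (simp add: d_def)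
  have "d * (D + 1) = e" using D_ge_1 by (simp add: d_def)
  then have ed: "e = d + d * D" by (simp add: algebra_simps)
  obtain \<eta> where eta: "0 < \<eta>" "\<eta> \<le> 1 / 2" and
    win: "eventually (\<lambda>x. \<forall>N. G N (x * (1 - \<eta>)) - G N (x * (1 + \<eta>)) \<le> d * Fbar F x) at_top"
    using G_window[OF d] by blast
  have "eventually (\<lambda>x. \<forall>N\<in>I. Wtail N (x * (1 - \<eta>)) \<le> G N x + e * Fbar F x
         \<and> G N x - e * Fbar F x \<le> Wtail N (x * (1 + \<eta>))) at_top"
    if asym: "\<And>e. e > 0 \<Longrightarrow> eventually (\<lambda>x. \<forall>N\<in>I. \<bar>Wtail N x - G N x\<bar> \<le> e * Fbar F x) at_top" for I
  proof -
    have 1: "eventually (\<lambda>x. \<forall>N\<in>I. \<bar>Wtail N (x * (1 - \<eta>)) - G N (x * (1 - \<eta>))\<bar> \<le> d * Fbar F (x * (1 - \<eta>))) at_top"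
      by (rule eventually_at_top_scale[OF asym[OF d]]) (use eta in simp)
    have 2: "eventually (\<lambda>x. \<forall>N\<in>I. \<bar>Wtail N (x * (1 + \<eta>)) - G N (x * (1 + \<eta>))\<bar> \<le> d * Fbar F (x * (1 + \<eta>))) at_top"
      by (rule eventually_at_top_scale[OF asym[OF d]]) (use eta in simp)
    show ?thesis using 1 2 win eventually_ge_at_top[of 0]
    proof eventually_elim
      case (elim x)
      have le: "x / 2 \<le> x * (1 - \<eta>)" "x * (1 - \<eta>) \<le> x" "x \<le> x * (1 + \<eta>)"
        using eta elim mult_left_mono[of "1 / 2" "1 - \<eta>" x] by (auto simp: algebra_simps)
      have m0: "m ^ i \<ge> 0" for i using m_gt1 by simp
      have Gx: "G N x \<le> G N (x * (1 - \<eta>))" "G N (x * (1 + \<eta>)) \<le> G N x" for N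
        unfolding G_def using le m0[of "_ + 1"] m0
        by (auto intro!: sum_mono mult_left_mono Fbar_antimono simp del: power_Suc)
      have "d * Fbar F (x * (1 - \<eta>)) \<le> d * (D * Fbar F x)"
        using d Fbar_antimono[OF le(1), of F] dominated[of x] by (intro mult_left_mono) auto
      moreover have "d * Fbar F (x * (1 + \<eta>)) \<le> d * Fbar F x"
        using d le by (intro mult_left_mono Fbar_antimono) auto
      moreover have "G N (x * (1 - \<eta>)) - G N (x * (1 + \<eta>)) \<le> d * Fbar F x" for N using elim by blast
      moreover have "d * D * Fbar F x \<ge> d * Fbar F x" using d D_ge_1 by (intro mult_right_mono) auto
      ultimately have bounds: "Wtail N (x * (1 - \<eta>)) \<le> G N x + e * Fbar F x \<and> G N x - e * Fbar F x \<le> Wtail N (x * (1 + \<eta>))"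
        if "\<bar>Wtail N (x * (1 - \<eta>)) - G N (x * (1 - \<eta>))\<bar> \<le> d * Fbar F (x * (1 - \<eta>))"
           "\<bar>Wtail N (x * (1 + \<eta>)) - G N (x * (1 + \<eta>))\<bar> \<le> d * Fbar F (x * (1 + \<eta>))" for N
        using that Gx[of N] unfolding ed by (simp add: algebra_simps abs_le_iff) (smt (verit))
      show ?case by (intro ballI bounds) (use elim(1,2) in blast)+
    qed
  qed
  with eta that show ?thesis by blast
qed

lemma Wtail_asymptotic_fixed:
  assumes "e > 0"
  shows "eventually (\<lambda>x. \<bar>Wtail N x - G N x\<bar> \<le> e * Fbar F x) at_top"
  using assms
proof (induction N arbitrary: e)
  case 0
  show ?case using eventually_ge_at_top[of 1]
    by eventually_elim (use 0 in \<open>auto simp: Wtail_0 G_def\<close>)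
next
  case (Suc N)
  obtain C0 where C0: "C0 \<ge> 0" "\<And>n x. x \<ge> 2 \<Longrightarrow> Wtail n x \<le> C0 * Fbar F x"
    using Wtail_le by blast
  \<comment> \<open>The lower bound has three errors \<open>d\<close>, and the factor
    \<open>1 - d\<close> in front of \<open>Wtail N\<close> costs another
    \<open>C0 * d\<close>.\<close>
  define d where "d = min 1 (e / (C0 + 3))"
  have d: "d > 0" "d \<le> 1" using Suc.prems C0 by (auto simp: d_def)
  have "d \<le> e / (C0 + 3)" by (simp add: d_def)
  then have de: "d * (C0 + 3) \<le> e" using C0 by (simp add: field_simps)
  obtain \<eta> where eta: "0 < \<eta>" "\<eta> \<le> 1 / 2" and
    win: "\<And>I. (\<And>e. e > 0 \<Longrightarrow> eventually (\<lambda>x. \<forall>N\<in>I. \<bar>Wtail N x - G N x\<bar> \<le> e * Fbar F x) at_top) \<Longrightarrow>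
       eventually (\<lambda>x. \<forall>N\<in>I. Wtail N (x * (1 - \<eta>)) \<le> G N x + d * Fbar F x
         \<and> G N x - d * Fbar F x \<le> Wtail N (x * (1 + \<eta>))) at_top"
    using Wtail_window[OF d(1)] by blast
  have eta1: "\<eta> < 1" using eta by simp
  obtain C where C: "C \<ge> 1" "\<And>k y. y \<ge> 1 \<Longrightarrow> real k * m \<le> y * (1 - \<eta>) \<Longrightarrow>
       measure_pmf.prob (sum_pmf F k) {b. real b > y} \<le> C * real k * Fbar F y"
    using sum_pmf_linear_bound[OF eta(1) eta1] by blast
  \<comment> \<open>Above this cut-off the linear bound contributes at most \<open>d\<close> times
    the tail; below it finitely many \<open>k\<close> remain, each with its own asymptotics.\<close>
  obtain K where K: "measure_pmf.expectation (generation_pmf F N) (\<lambda>k. if k > K then real k else 0) < d / C"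
    using generation_pmf_tail_expectation[of "d / C" N thesis] d C by simp
  let ?E = "measure_pmf.expectation (generation_pmf F N)"
  let ?t = "?E (\<lambda>k. if k > K then real k else 0)"
  have int_t: "integrable (generation_pmf F N) (\<lambda>k. if k > K then real k else 0)"
    by (rule Bochner_Integration.integrable_bound[OF integrable_generation_pmf[of N]]) auto
  have t0: "?t \<ge> 0" by (rule integral_nonneg_AE) auto
  have tC: "C * ?t \<le> d" using K C by (simp add: field_simps)
  have "1 * ?t \<le> C * ?t" using C t0 by (intro mult_right_mono) auto
  then have td: "?t \<le> d" using tC by simp
  let ?M = "m ^ Suc N"
  have M: "?M > 0" "m ^ N > 0" "m ^ N \<ge> 1" using m_gt1 by (auto intro: one_le_power)
  have "eventually (\<lambda>y. \<forall>k\<in>{..K}. \<bar>measure_pmf.prob (sum_pmf F k) {b. real b > y} - real k * Fbar F y\<bar> \<le> d * Fbar F y) at_top"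
    by (intro eventually_ball_finite ballI sum_pmf_asymptotic d) auto
  from eventually_at_top_scale[OF this M(1)] have asym:
    "eventually (\<lambda>x. \<forall>k\<in>{..K}. \<bar>measure_pmf.prob (sum_pmf F k) {b. real b > ?M * x} - real k * Fbar F (?M * x)\<bar> \<le> d * Fbar F (?M * x)) at_top"
    by (simp add: mult.commute)
  \<comment> \<open>Chosen with \<open>(1 + \<eta>) * (1 - \<epsilon>) = 1\<close>: a relative loss
    of \<open>\<epsilon>\<close> from the level \<open>x * (1 + \<eta>)\<close> leads exactly to
    \<open>x\<close>.\<close>
  define \<epsilon> where "\<epsilon> = \<eta> / (1 + \<eta>)"
  have eps: "\<epsilon> > 0" "1 - \<epsilon> = 1 / (1 + \<eta>)" using eta by (auto simp: \<epsilon>_def field_simps)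
  define L where "L = 34 * V / (m * \<epsilon> / 2) powr p"
  have L: "L \<ge> 0" using V_pos by (simp add: L_def)
  have small: "eventually (\<lambda>x. L * x powr (1 - p) < d) at_top"
    by (rule order_tendstoD(2)[OF one_minus_p_tendsto d(1)])
  have "eventually (\<lambda>x. Wtail N (x * (1 - \<eta>)) \<le> G N x + d * Fbar F x
         \<and> G N x - d * Fbar F x \<le> Wtail N (x * (1 + \<eta>))) at_top"
    using win[of "{N}"] Suc.IH by simp
  then show ?case
    using asym small eventually_ge_at_top[of "max 2 (real K)"]
  proof eventually_elim
    case (elim x)
    have x: "x \<ge> 2" "x \<ge> real K" using elim by auto
    have MNx: "m ^ N * x \<ge> x" using M x by simp
    have "1 * 1 \<le> ?M * x" using x m_gt1 by (intro mult_mono one_le_power) auto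
    then have Mx: "?M * x \<ge> 1" by simp
    have BM: "Fbar F (?M * x) \<le> Fbar F x"
      using x m_gt1 mult_right_mono[of 1 ?M x] by (intro Fbar_antimono) (auto intro: one_le_power simp del: power_Suc)
    let ?B = "Fbar F x" and ?BM = "Fbar F (?M * x)"
    let ?P = "\<lambda>k. measure_pmf.prob (sum_pmf F k) {b. real b > ?M * x}"
    have "Wtail (Suc N) x \<le> Wtail N (x * (1 - \<eta>)) + ?E (\<lambda>k. real k * ?BM + d * ?BM + (C * ?BM) * (if k > K then real k else 0))"
    proof (rule Wtail_Suc_upper)
      show "integrable (generation_pmf F N) (\<lambda>k. real k * ?BM + d * ?BM + (C * ?BM) * (if k > K then real k else 0))"
        using integrable_generation_pmf int_t by simp
      show "0 \<le> real k * ?BM + d * ?BM + (C * ?BM) * (if k > K then real k else 0)" for k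
        using d C by simp
      fix k assume k: "real k \<le> m ^ N * (x * (1 - \<eta>))"
      show "?P k \<le> real k * ?BM + d * ?BM + (C * ?BM) * (if k > K then real k else 0)"
      proof (cases "k \<le> K")
        case True
        then have "\<bar>?P k - real k * ?BM\<bar> \<le> d * ?BM" using elim(2) by simp
        then show ?thesis using True by (simp add: abs_le_iff)
      next
        case False
        have "real k * m \<le> (m ^ N * (x * (1 - \<eta>))) * m" using k m_gt1 by (intro mult_right_mono) auto
        then have "?P k \<le> C * real k * ?BM" using Mx by (intro C(2)) (auto simp: algebra_simps)
        moreover have "0 \<le> real k * ?BM + d * ?BM" using d by simp
        ultimately show ?thesis using False by (simp add: algebra_simps)
      qed
    qed
    also have "?E (\<lambda>k. real k * ?BM + d * ?BM + (C * ?BM) * (if k > K then real k else 0)) = m ^ N * ?BM + d * ?BM + (C * ?t) * ?BM"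
      using integrable_generation_pmf int_t by (simp add: expectation_generation_pmf)
    also have "\<dots> \<le> m ^ N * ?BM + d * ?B + d * ?B"
      using BM tC d C(1) t0 m_gt1 by (intro add_mono mult_left_mono mult_mono) auto
    finally have up: "Wtail (Suc N) x \<le> G (Suc N) x + 3 * d * ?B"
      using elim(1) by (simp add: G_Suc algebra_simps)
    \<comment> \<open>For \<open>k \<le> K\<close> the first term is the one-big-jump estimate, for
      \<open>k > K\<close> it is the nonpositive \<open>- d * ?BM\<close>; as
      \<open>x \<ge> K\<close>, all populations counted by the second term exceed
      \<open>K\<close>.\<close>
    have "?E (\<lambda>k. ?BM * (real k - d - (if k > K then real k else 0))) + (1 - d) * Wtail N (x * (1 + \<eta>)) \<le> Wtail (Suc N) x"
    proof (rule Wtail_Suc_lower)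
      show "integrable (generation_pmf F N) (\<lambda>k. ?BM * (real k - d - (if k > K then real k else 0)))"
        using integrable_generation_pmf int_t by simp
      fix k
      have Klt: "m ^ N * (x * (1 + \<eta>)) > real K"
      proof -
        have "m ^ N * x < m ^ N * (x * (1 + \<eta>))" using x eta M by simp
        then show ?thesis using MNx x by linarith
      qed
      show "?BM * (real k - d - (if k > K then real k else 0)) + (if real k > m ^ N * (x * (1 + \<eta>)) then 1 - d else 0) \<le> ?P k"
      proof (cases "k \<le> K")
        case True
        then have "\<bar>?P k - real k * ?BM\<bar> \<le> d * ?BM" using elim(2) by simp
        then show ?thesis using True Klt by (auto simp: abs_le_iff algebra_simps)
      next
        case False
        have dB: "?BM * (real k - d - (if k > K then real k else 0)) \<le> 0" using False d by (simp add: mult_nonneg_nonpos)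
        show ?thesis
        proof (cases "real k > m ^ N * (x * (1 + \<eta>))")
          case True
          have "?M * x = (m ^ N * (x * (1 + \<eta>))) * (m * (1 - \<epsilon>))" using eta unfolding eps by simp
          also have "\<dots> \<le> real k * (m * (1 - \<epsilon>))"
            using True m_gt1 eta unfolding eps by (intro mult_right_mono) auto
          finally have "1 - 34 * V * real k powr (1 - p) / (m * \<epsilon> / 2) powr p \<le> ?P k"
            using False m_gt1 eps by (intro sum_pmf_stays_above) (auto simp: mult.assoc)
          moreover have "34 * V * real k powr (1 - p) / (m * \<epsilon> / 2) powr p = L * real k powr (1 - p)" by (simp add: L_def)
          moreover have "L * real k powr (1 - p) \<le> L * x powr (1 - p)"
          proof (intro mult_left_mono powr_mono2')
            have "x * 1 \<le> x * (1 + \<eta>)" using x eta by (intro mult_left_mono) auto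
            moreover have "1 * (x * (1 + \<eta>)) \<le> m ^ N * (x * (1 + \<eta>))" using M x eta by (intro mult_right_mono) auto
            ultimately show "x \<le> real k" using True by simp
          qed (use L p_gt_1 x in auto)
          ultimately show ?thesis using True dB elim(3) by simp
        next
          case not_gt: False
          have "0 \<le> ?P k" by simp
          with dB show ?thesis unfolding if_not_P[OF not_gt] add_0_right by (rule order_trans)
        qed
      qed
    qed
    also have "?E (\<lambda>k. ?BM * (real k - d - (if k > K then real k else 0))) = ?BM * (m ^ N - d - ?t)"
      using integrable_generation_pmf int_t by (simp add: expectation_generation_pmf)
    finally have low1: "?BM * (m ^ N - d - ?t) + (1 - d) * Wtail N (x * (1 + \<eta>)) \<le> Wtail (Suc N) x" .
    have "?BM * (d + ?t) \<le> ?B * (d + d)" using BM td d t0 by (intro mult_mono) auto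
    moreover have "d * Wtail N (x * (1 + \<eta>)) \<le> d * (C0 * ?B)"
    proof (intro mult_left_mono)
      have "Wtail N (x * (1 + \<eta>)) \<le> Wtail N x" using x eta by (intro Wtail_antimono) (simp add: algebra_simps)
      then show "Wtail N (x * (1 + \<eta>)) \<le> C0 * ?B" using C0(2)[OF x(1), of N] by linarith
    qed (use d in auto)
    ultimately have low: "G (Suc N) x - (C0 + 3) * d * ?B \<le> Wtail (Suc N) x"
      using low1 elim(1) by (simp add: G_Suc algebra_simps)
    have "(C0 + 3) * d * ?B \<le> e * ?B" using de by (intro mult_right_mono) (auto simp: mult.commute)
    moreover have "3 * d * ?B \<le> (C0 + 3) * d * ?B" using C0 d by (intro mult_right_mono) auto
    ultimately show ?case using up low by (simp add: abs_le_iff)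
  qed
qed

lemma Wtail_asymptotic_uniform:
  assumes "e > 0"
  shows "eventually (\<lambda>x. \<forall>n. \<bar>Wtail n x - G n x\<bar> \<le> e * Fbar F x) at_top"
proof -
  obtain C0 where C0: "C0 \<ge> 0" "\<And>n x. x \<ge> 2 \<Longrightarrow> Wtail n x \<le> C0 * Fbar F x"
    using Wtail_le by blast
  obtain C1 where C1: "C1 \<ge> 0"
    "\<And>N n x. N \<le> n \<Longrightarrow> x > 1 \<Longrightarrow> Wtail n x \<le> Wtail N (x * (1 - q ^ N / 2)) + C1 * q ^ N * Fbar F x"
    using Wtail_upper by blast
  obtain C2 where C2: "C2 \<ge> 0"
    "\<And>N n x. N \<le> n \<Longrightarrow> x > 0 \<Longrightarrow> Wtail N (x * (1 + q ^ N)) * (1 - C2 * x powr (1 - p)) \<le> Wtail n x"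
    using Wtail_lower by blast
  obtain C3 where C3: "C3 \<ge> 1" "\<And>N n x. N \<le> n \<Longrightarrow> x > 1 \<Longrightarrow> G n x \<le> G N x + C3 * \<theta> ^ N * Fbar F x"
    using G_tail_bound by blast
  \<comment> \<open>The lower bound spends one \<open>d\<close> on the window, one on the tail of
    \<open>G\<close> and \<open>C0 * d\<close> on the factor \<open>1 - d\<close>.\<close>
  define d where "d = e / (C0 + 2)"
  have d: "d > 0" using assms C0 by (simp add: d_def)
  have de: "d * (C0 + 2) = e" using C0 by (simp add: d_def)
  obtain \<eta> where eta: "0 < \<eta>" "\<eta> \<le> 1 / 2" and
    win: "\<And>I. (\<And>e. e > 0 \<Longrightarrow> eventually (\<lambda>x. \<forall>N\<in>I. \<bar>Wtail N x - G N x\<bar> \<le> e * Fbar F x) at_top) \<Longrightarrow>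
       eventually (\<lambda>x. \<forall>N\<in>I. Wtail N (x * (1 - \<eta>)) \<le> G N x + d * Fbar F x
         \<and> G N x - d * Fbar F x \<le> Wtail N (x * (1 + \<eta>))) at_top"
    using Wtail_window[OF d(1)] by blast
  have lim0: "(\<lambda>n. C * r ^ n) \<longlonglongrightarrow> 0" if "0 < r" "r < 1" for C r :: real
    using tendsto_mult[OF tendsto_const[of C] LIMSEQ_power_zero[of r]] that by simp
  have "eventually (\<lambda>N. C1 * q ^ N < d) sequentially"
    by (rule order_tendstoD(2)[OF lim0]) (use q_pos q_less_1 d in auto)
  moreover have "eventually (\<lambda>N. C3 * \<theta> ^ N < d) sequentially"
    by (rule order_tendstoD(2)[OF lim0]) (use theta_pos theta_less_1 d in auto)
  moreover have "eventually (\<lambda>N. 1 * q ^ N < \<eta>) sequentially"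
    by (rule order_tendstoD(2)[OF lim0]) (use q_pos q_less_1 eta in auto)
  ultimately have "eventually (\<lambda>N. C1 * q ^ N < d \<and> C3 * \<theta> ^ N < d \<and> q ^ N < \<eta>) sequentially"
    by eventually_elim auto
  \<comment> \<open>From this generation on the window \<open>\<eta>\<close> contains the shift
    \<open>q ^ N\<close> and both geometric remainders are below \<open>d\<close>; the earlier
    generations are finitely many.\<close>
  then obtain N where N: "C1 * q ^ N < d" "C3 * \<theta> ^ N < d" "q ^ N < \<eta>"
    by (auto simp: eventually_sequentially)
  have small: "eventually (\<lambda>x. C2 * x powr (1 - p) < d) at_top"
    by (rule order_tendstoD(2)[OF one_minus_p_tendsto d(1)])
  have fin: "eventually (\<lambda>x. \<forall>n\<in>{..<N}. \<bar>Wtail n x - G n x\<bar> \<le> e * Fbar F x) at_top"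
    by (intro eventually_ball_finite ballI Wtail_asymptotic_fixed assms) auto
  have "eventually (\<lambda>x. Wtail N (x * (1 - \<eta>)) \<le> G N x + d * Fbar F x
         \<and> G N x - d * Fbar F x \<le> Wtail N (x * (1 + \<eta>))) at_top"
    using win[of "{N}"] Wtail_asymptotic_fixed by simp
  then show ?thesis
    using small fin eventually_ge_at_top[of 2]
  proof eventually_elim
    case (elim x)
    let ?B = "Fbar F x"
    have "\<bar>Wtail n x - G n x\<bar> \<le> e * ?B" if n: "n \<ge> N" for n
    proof -
      have "Wtail n x \<le> Wtail N (x * (1 - q ^ N / 2)) + C1 * q ^ N * ?B"
        using n elim by (intro C1(2)) auto
      also have "\<dots> \<le> Wtail N (x * (1 - \<eta>)) + d * ?B"
      proof (intro add_mono mult_right_mono Wtail_antimono mult_left_mono)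
        show "1 - \<eta> \<le> 1 - q ^ N / 2" using N q_pos zero_less_power[of q N] by linarith
      qed (use N elim in auto)
      also have "\<dots> \<le> G N x + 2 * d * ?B" using elim(1) by (simp add: algebra_simps)
      also have "G N x \<le> G n x" by (rule G_mono[OF n])
      finally have up: "Wtail n x \<le> G n x + 2 * d * ?B" by simp
      have "G n x \<le> G N x + C3 * \<theta> ^ N * ?B" using n elim by (intro C3(2)) auto
      also have "\<dots> \<le> G N x + d * ?B" using N by (intro add_left_mono mult_right_mono) auto
      finally have g: "G n x \<le> G N x + d * ?B" .
      have "G N x - d * ?B \<le> Wtail N (x * (1 + \<eta>))" using elim by blast
      also have "\<dots> \<le> Wtail N (x * (1 + q ^ N))" using N elim by (intro Wtail_antimono mult_left_mono) auto
      finally have w: "G N x - d * ?B \<le> Wtail N (x * (1 + q ^ N))" .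
      have "Wtail N (x * (1 + q ^ N)) \<le> Wtail N x"
        using elim q_pos by (intro Wtail_antimono) simp
      also have "\<dots> \<le> C0 * ?B" using C0(2) elim by blast
      finally have c: "Wtail N (x * (1 + q ^ N)) \<le> C0 * ?B" .
      have "Wtail N (x * (1 + q ^ N)) * d \<le> C0 * ?B * d" using c d by (intro mult_right_mono) auto
      moreover have "Wtail N (x * (1 + q ^ N)) * (1 - d) \<le> Wtail N (x * (1 + q ^ N)) * (1 - C2 * x powr (1 - p))"
        using elim by (intro mult_left_mono) auto
      moreover have "Wtail N (x * (1 + q ^ N)) * (1 - C2 * x powr (1 - p)) \<le> Wtail n x"
        using n elim by (intro C2(2)) auto
      ultimately have "G N x - d * ?B - C0 * ?B * d \<le> Wtail n x" using w by (simp add: algebra_simps)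
      then have low: "G n x - d * (C0 + 2) * ?B \<le> Wtail n x" using g by (simp add: algebra_simps)
      have "2 * d * ?B \<le> d * (C0 + 2) * ?B" using C0 d by (intro mult_right_mono) auto
      then show ?thesis using up low unfolding de by (simp add: abs_le_iff)
    qed
    then show ?case using elim(3) by (metis lessThan_iff not_le)
  qed
qed

end

section \<open>The process on its probability space\<close>

lemma measurable_nat_add:
  fixes f g :: "'b \<Rightarrow> nat"
  assumes "f \<in> N \<rightarrow>\<^sub>M count_space UNIV" "g \<in> N \<rightarrow>\<^sub>M count_space UNIV"
  shows "(\<lambda>\<omega>. f \<omega> + g \<omega>) \<in> N \<rightarrow>\<^sub>M count_space UNIV"
proof (rule measurable_compose_countable[OF _ assms(1)])
  show "(\<lambda>\<omega>. i + g \<omega>) \<in> N \<rightarrow>\<^sub>M count_space UNIV" for i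
    by (rule measurable_compose[OF assms(2)]) simp
qed

lemma measurable_nat_sum:
  fixes f :: "nat \<Rightarrow> 'b \<Rightarrow> nat"
  assumes "\<And>i. f i \<in> N \<rightarrow>\<^sub>M count_space UNIV"
  shows "(\<lambda>\<omega>. \<Sum>i\<in>{1..k}. f i \<omega>) \<in> N \<rightarrow>\<^sub>M count_space UNIV"
  by (induction k) (auto intro!: measurable_nat_add assms)

lemma measurable_gw_Z:
  assumes "\<And>i j. j < n \<Longrightarrow> X i j \<in> N \<rightarrow>\<^sub>M count_space UNIV"
  shows "gw_Z X n \<in> N \<rightarrow>\<^sub>M count_space UNIV"
  using assms
proof (induction n)
  case 0
  have "gw_Z X 0 = (\<lambda>_. 1)" by (simp add: fun_eq_iff)
  then show ?case by simp
next
  case (Suc n)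
  have "(\<lambda>\<omega>. \<Sum>i\<in>{1..gw_Z X n \<omega>}. X i n \<omega>) \<in> N \<rightarrow>\<^sub>M count_space UNIV"
  proof (rule measurable_compose_countable[where f="\<lambda>k \<omega>. \<Sum>i\<in>{1..k}. X i n \<omega>"])
    show "(\<lambda>\<omega>. \<Sum>i\<in>{1..k}. X i n \<omega>) \<in> N \<rightarrow>\<^sub>M count_space UNIV" for k
      by (rule measurable_nat_sum) (rule Suc.prems, simp)
    show "gw_Z X n \<in> N \<rightarrow>\<^sub>M count_space UNIV" by (rule Suc.IH) (rule Suc.prems, simp)
  qed
  then show ?case by (simp add: fun_eq_iff[symmetric] cong: measurable_cong)
qed

lemma gw_Z_cong:
  assumes "\<And>i j. j < n \<Longrightarrow> X i j \<omega> = Y i j \<omega>'"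
  shows "gw_Z X n \<omega> = gw_Z Y n \<omega>'"
  using assms by (induction n) auto

text \<open>The second variable carries a random index. Splitting the event along the countably many
  values \<open>k\<close> of \<open>X\<close> leaves only the pairs of \<open>X\<close> and
  \<open>Y k\<close>; with \<open>X = Z_n\<close> this is the Markov property.\<close>

lemma (in prob_space) prob_indep_pair:
  fixes X :: "'a \<Rightarrow> nat" and Y :: "nat \<Rightarrow> 'a \<Rightarrow> nat"
  assumes ind: "\<And>k. indep_var (count_space UNIV) X (count_space UNIV) (Y k)"
    and X: "\<And>A. prob {\<omega>\<in>space M. X \<omega> \<in> A} = measure_pmf.prob p A"
    and Y: "\<And>k A. prob {\<omega>\<in>space M. Y k \<omega> \<in> A} = measure_pmf.prob (q k) A"
  shows "prob {\<omega>\<in>space M. R (X \<omega>) (Y (X \<omega>) \<omega>)} = measure_pmf.expectation p (\<lambda>k. measure_pmf.prob (q k) {b. R k b})"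
proof -
  have rv: "X \<in> M \<rightarrow>\<^sub>M count_space UNIV" "\<And>k. Y k \<in> M \<rightarrow>\<^sub>M count_space UNIV"
    using indep_var_rv1[OF ind] indep_var_rv2[OF ind] by auto
  define E where "E k = X -` {k} \<inter> Y k -` {b. R k b} \<inter> space M" for k
  have E: "E k \<in> sets M" for k
  proof -
    have "E k = (X -` {k} \<inter> space M) \<inter> (Y k -` {b. R k b} \<inter> space M)" by (auto simp: E_def)
    then show ?thesis using measurable_sets[OF rv(1), of "{k}"] measurable_sets[OF rv(2), of "{b. R k b}" k] by auto
  qed
  have prE: "prob (E k) = pmf p k * measure_pmf.prob (q k) {b. R k b}" for k
  proof -
    have "E k = (\<lambda>x. (X x, Y k x)) -` ({k} \<times> {b. R k b}) \<inter> space M" by (auto simp: E_def)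
    then have "prob (E k) = prob (X -` {k} \<inter> space M) * prob (Y k -` {b. R k b} \<inter> space M)"
      using indep_varD[OF ind, of "{k}" "{b. R k b}" k] by simp
    also have "X -` {k} \<inter> space M = {\<omega>\<in>space M. X \<omega> \<in> {k}}" by auto
    also have "Y k -` {b. R k b} \<inter> space M = {\<omega>\<in>space M. Y k \<omega> \<in> {b. R k b}}" by auto
    finally show ?thesis unfolding X Y by (simp add: measure_pmf_single)
  qed
  have "{\<omega>\<in>space M. R (X \<omega>) (Y (X \<omega>) \<omega>)} = (\<Union>k. E k)" by (auto simp: E_def)
  then have "emeasure M {\<omega>\<in>space M. R (X \<omega>) (Y (X \<omega>) \<omega>)} = (\<Sum>k. emeasure M (E k))"
    using E by (subst suminf_emeasure) (auto simp: disjoint_family_on_def E_def)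
  also have "\<dots> = (\<Sum>k. ennreal (pmf p k) * ennreal (measure_pmf.prob (q k) {b. R k b}))"
    by (simp add: emeasure_eq_measure prE ennreal_mult)
  also have "\<dots> = (\<integral>\<^sup>+k. ennreal (measure_pmf.prob (q k) {b. R k b}) \<partial>p)"
    by (simp add: nn_integral_measure_pmf nn_integral_count_space_nat)
  also have "\<dots> = ennreal (measure_pmf.expectation p (\<lambda>k. measure_pmf.prob (q k) {b. R k b}))"
    by (rule nn_integral_eq_integral) auto
  finally show ?thesis unfolding emeasure_eq_measure
    by (subst (asm) ennreal_inj) (auto intro!: integral_nonneg_AE)
qed

locale galton_watson = prob_space M for M :: "'a measure" +
  fixes F :: "nat pmf" and xi :: "nat \<Rightarrow> nat \<Rightarrow> 'a \<Rightarrow> nat"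
  assumes indep: "indep_vars (\<lambda>_. count_space UNIV) (\<lambda>p. xi (fst p) (snd p)) UNIV"
    and law: "\<And>i n. distr M (count_space UNIV) (xi i n) = measure_pmf F"
begin

lemma xi_measurable [measurable]: "xi i n \<in> M \<rightarrow>\<^sub>M count_space UNIV"
  using indep unfolding indep_vars_def by (auto dest: spec[of _ "(i, n)"])

lemma prob_xi: "prob {\<omega>\<in>space M. xi i n \<omega> \<in> A} = measure_pmf.prob F A"
proof -
  have "measure_pmf.prob F A = measure (distr M (count_space UNIV) (xi i n)) A" by (simp add: law)
  also have "\<dots> = prob (xi i n -` A \<inter> space M)" by (rule measure_distr) auto
  also have "xi i n -` A \<inter> space M = {\<omega>\<in>space M. xi i n \<omega> \<in> A}" by auto
  finally show ?thesis by simp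
qed

lemma indep_var_coordinates:
  assumes "A \<inter> B = {}"
    and f: "f \<in> PiM A (\<lambda>_. count_space UNIV) \<rightarrow>\<^sub>M count_space UNIV"
    and g: "g \<in> PiM B (\<lambda>_. count_space UNIV) \<rightarrow>\<^sub>M count_space UNIV"
    and X: "\<And>\<omega>. X \<omega> = f (\<lambda>p\<in>A. xi (fst p) (snd p) \<omega>)"
    and Y: "\<And>\<omega>. Y \<omega> = g (\<lambda>p\<in>B. xi (fst p) (snd p) \<omega>)"
  shows "indep_var (count_space UNIV) X (count_space UNIV) Y"
proof -
  have "indep_var (count_space UNIV) (f \<circ> (\<lambda>\<omega>. \<lambda>p\<in>A. xi (fst p) (snd p) \<omega>)) (count_space UNIV) (g \<circ> (\<lambda>\<omega>. \<lambda>p\<in>B. xi (fst p) (snd p) \<omega>))"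
    by (rule indep_var_compose[OF indep_var_restrict[OF indep assms(1)] f g]) auto
  moreover have "f \<circ> (\<lambda>\<omega>. \<lambda>p\<in>A. xi (fst p) (snd p) \<omega>) = X" "g \<circ> (\<lambda>\<omega>. \<lambda>p\<in>B. xi (fst p) (snd p) \<omega>) = Y"
    by (auto simp: X Y fun_eq_iff)
  ultimately show ?thesis by simp
qed

lemma prob_generation_sum:
  "prob {\<omega>\<in>space M. (\<Sum>i\<in>{1..k}. xi i n \<omega>) \<in> A} = measure_pmf.prob (sum_pmf F k) A"
proof (induction k arbitrary: A)
  case 0
  show ?case by (auto simp: indicator_def prob_space)
next
  case (Suc k)
  have "indep_var (count_space UNIV) (xi (Suc k) n) (count_space UNIV) (\<lambda>\<omega>. \<Sum>i\<in>{1..k}. xi i n \<omega>)"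
  proof (rule indep_var_coordinates[where A="{(Suc k, n)}" and B="{1..k} \<times> {n}"])
    \<comment> \<open>\<open>measurable_nat_sum\<close> asks for every \<open>i\<close>, so the
      \<open>if\<close> replaces coordinates outside the block, which
      \<open>measurable_component_singleton\<close> does not cover, by 0; the sum is
      unchanged.\<close>
    show "(\<lambda>f::nat \<times> nat \<Rightarrow> nat. \<Sum>i\<in>{1..k}. if i \<le> k \<and> 1 \<le> i then f (i, n) else 0) \<in> Pi\<^sub>M ({1..k} \<times> {n}) (\<lambda>_. count_space UNIV) \<rightarrow>\<^sub>M count_space UNIV"
    proof (rule measurable_nat_sum)
      fix i
      show "(\<lambda>f::nat \<times> nat \<Rightarrow> nat. if i \<le> k \<and> 1 \<le> i then f (i, n) else 0) \<in> Pi\<^sub>M ({1..k} \<times> {n}) (\<lambda>_. count_space UNIV) \<rightarrow>\<^sub>M count_space UNIV"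
        by (cases "i \<le> k \<and> 1 \<le> i") (auto intro: measurable_component_singleton)
    qed
    show "(\<lambda>f. f (Suc k, n)) \<in> Pi\<^sub>M {(Suc k, n)} (\<lambda>_. count_space UNIV) \<rightarrow>\<^sub>M count_space UNIV"
      by (rule measurable_component_singleton) simp
  qed auto
  from prob_indep_pair[OF this prob_xi Suc.IH, of "\<lambda>a b. a + b \<in> A"]
  show ?case unfolding prob_sum_pmf_Suc by (simp add: add.commute)
qed

lemma indep_var_generation:
  "indep_var (count_space UNIV) (gw_Z xi n) (count_space UNIV) (\<lambda>\<omega>. \<Sum>i\<in>{1..k}. xi i n \<omega>)"
proof (rule indep_var_coordinates[where A="{p. snd p < n}" and B="UNIV \<times> {n}"])
  \<comment> \<open>\<open>gw_Z\<close> itself, read as a functional of the array, shows that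
    \<open>Z_n\<close> depends only on the reproduction of earlier generations.\<close>
  show "gw_Z (\<lambda>i j f. f (i, j)) n \<in> Pi\<^sub>M {p. snd p < n} (\<lambda>_. count_space UNIV) \<rightarrow>\<^sub>M count_space UNIV"
    by (rule measurable_gw_Z) (auto intro: measurable_component_singleton)
  show "(\<lambda>f::nat \<times> nat \<Rightarrow> nat. \<Sum>i\<in>{1..k}. f (i, n)) \<in> Pi\<^sub>M (UNIV \<times> {n}) (\<lambda>_. count_space UNIV) \<rightarrow>\<^sub>M count_space UNIV"
    by (rule measurable_nat_sum) (auto intro: measurable_component_singleton)
  show "gw_Z xi n \<omega> = gw_Z (\<lambda>i j f. f (i, j)) n (\<lambda>p\<in>{p. snd p < n}. xi (fst p) (snd p) \<omega>)" for \<omega>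
    by (rule gw_Z_cong) auto
qed auto

lemma prob_gw_Z: "prob {\<omega>\<in>space M. gw_Z xi n \<omega> \<in> A} = measure_pmf.prob (generation_pmf F n) A"
proof (induction n arbitrary: A)
  case 0
  show ?case by (auto simp: indicator_def prob_space)
next
  case (Suc n)
  from prob_indep_pair[OF indep_var_generation Suc.IH prob_generation_sum, of "\<lambda>k b. b \<in> A"]
  show ?case by (simp add: measure_pmf_prob_bind)
qed

lemma prob_gw_Z_step:
  "prob {\<omega>\<in>space M. R (gw_Z xi n \<omega>) (gw_Z xi (Suc n) \<omega>)}
    = measure_pmf.expectation (generation_pmf F n) (\<lambda>k. measure_pmf.prob (sum_pmf F k) {b. R k b})"
  using prob_indep_pair[OF indep_var_generation prob_gw_Z prob_generation_sum, of R] by simp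

lemma gw_Z_measurable [measurable]: "gw_Z xi n \<in> M \<rightarrow>\<^sub>M count_space UNIV"
  by (rule measurable_gw_Z) simp

lemma gw_W_measurable [measurable]: "gw_W xi m n \<in> borel_measurable M"
proof -
  have "(\<lambda>\<omega>. (\<lambda>k. real k / m ^ n) (gw_Z xi n \<omega>)) \<in> borel_measurable M"
    by (rule measurable_compose[OF gw_Z_measurable]) simp
  then show ?thesis by (simp add: gw_W_def[abs_def])
qed

lemma gw_Wlim_measurable [measurable]: "gw_Wlim xi m \<in> borel_measurable M"
  unfolding gw_Wlim_def[abs_def] by (rule borel_measurable_lim_metric) simp

text \<open>Tails need not converge at an atom of the limit law, so two levels \<open>x < x'\<close>
  are used: a continuous ramp from 0 at \<open>x\<close> to 1 at \<open>x'\<close> lies between the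
  two indicators.\<close>

lemma prob_gw_Wlim_bounds:
  assumes conv: "AE \<omega> in M. (\<lambda>n. gw_W xi m n \<omega>) \<longlonglongrightarrow> gw_Wlim xi m \<omega>" and "x < x'"
  shows "(\<And>n. n \<ge> N \<Longrightarrow> prob {\<omega>\<in>space M. gw_W xi m n \<omega> > x} \<le> B) \<Longrightarrow> prob {\<omega>\<in>space M. gw_Wlim xi m \<omega> > x'} \<le> B"
    and "(\<And>n. n \<ge> N \<Longrightarrow> B \<le> prob {\<omega>\<in>space M. gw_W xi m n \<omega> > x'}) \<Longrightarrow> B \<le> prob {\<omega>\<in>space M. gw_Wlim xi m \<omega> > x}"
proof -
  define f where "f t = max 0 (min 1 ((t - x) / (x' - x)))" for t :: real
  have f0: "f t \<ge> 0" and f1: "f t \<le> 1" for t by (auto simp: f_def)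
  have cont: "continuous_on UNIV f" unfolding f_def using assms(2) by (intro continuous_intros) auto
  then have [measurable]: "f \<in> borel_measurable borel" by (rule borel_measurable_continuous_onI)
  have f_le: "f t \<le> indicator {x<..} t" for t
    using assms(2) by (auto simp: f_def indicator_def divide_nonpos_pos)
  have f_ge: "indicator {x'<..} t \<le> f t" for t
    using assms(2) by (auto simp: f_def indicator_def)
  have int: "integrable M (\<lambda>\<omega>. f (Y \<omega>))" if "Y \<in> borel_measurable M" for Y
    by (rule integrable_const_bound[where B=1]) (use that f0 f1 in auto)
  have ind: "integrable M (\<lambda>\<omega>. indicator {t<..} (Y \<omega>) :: real)" if "Y \<in> borel_measurable M" for Y and t :: real
    by (rule integrable_const_bound[where B=1]) (auto intro!: measurable_compose[OF that borel_measurable_indicator])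
  have prob_ind: "(\<integral>\<omega>. indicator {t<..} (Y \<omega>) \<partial>M) = prob {\<omega>\<in>space M. Y \<omega> > t}" for Y and t :: real
  proof -
    have "(\<integral>\<omega>. indicator {t<..} (Y \<omega>) \<partial>M) = (\<integral>\<omega>. indicator {\<omega>\<in>space M. Y \<omega> > t} \<omega> \<partial>M :: real)"
      by (intro Bochner_Integration.integral_cong) (auto simp: indicator_def)
    also have "\<dots> = prob ({\<omega>\<in>space M. Y \<omega> > t} \<inter> space M)" by simp
    also have "{\<omega>\<in>space M. Y \<omega> > t} \<inter> space M = {\<omega>\<in>space M. Y \<omega> > t}" by auto
    finally show ?thesis .
  qed
  have up: "(\<integral>\<omega>. f (Y \<omega>) \<partial>M) \<le> prob {\<omega>\<in>space M. Y \<omega> > x}" if [measurable]: "Y \<in> borel_measurable M" for Y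
    unfolding prob_ind[symmetric] by (rule integral_mono[OF int ind f_le]) measurable
  have low: "prob {\<omega>\<in>space M. Y \<omega> > x'} \<le> (\<integral>\<omega>. f (Y \<omega>) \<partial>M)" if [measurable]: "Y \<in> borel_measurable M" for Y
    unfolding prob_ind[symmetric] by (rule integral_mono[OF ind int f_ge]) measurable
  have lim: "(\<lambda>n. \<integral>\<omega>. f (gw_W xi m n \<omega>) \<partial>M) \<longlonglongrightarrow> (\<integral>\<omega>. f (gw_Wlim xi m \<omega>) \<partial>M)"
  proof (rule integral_dominated_convergence[where w="\<lambda>_. 1"])
    show "AE \<omega> in M. (\<lambda>n. f (gw_W xi m n \<omega>)) \<longlonglongrightarrow> f (gw_Wlim xi m \<omega>)"
      using conv by eventually_elim (rule continuous_on_tendsto_compose[OF cont], auto)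
  qed (use f0 f1 in auto)
  show "prob {\<omega>\<in>space M. gw_Wlim xi m \<omega> > x'} \<le> B"
    if "\<And>n. n \<ge> N \<Longrightarrow> prob {\<omega>\<in>space M. gw_W xi m n \<omega> > x} \<le> B"
  proof -
    have "(\<integral>\<omega>. f (gw_Wlim xi m \<omega>) \<partial>M) \<le> B"
      by (rule LIMSEQ_le_const2[OF lim]) (use that up[OF gw_W_measurable] order_trans in blast)
    with low[OF gw_Wlim_measurable] show ?thesis by (rule order_trans)
  qed
  show "B \<le> prob {\<omega>\<in>space M. gw_Wlim xi m \<omega> > x}"
    if "\<And>n. n \<ge> N \<Longrightarrow> B \<le> prob {\<omega>\<in>space M. gw_W xi m n \<omega> > x'}"
  proof -
    have "B \<le> (\<integral>\<omega>. f (gw_Wlim xi m \<omega>) \<partial>M)"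
      by (rule LIMSEQ_le_const[OF lim]) (use that low[OF gw_W_measurable] order_trans in blast)
    also have "\<dots> \<le> prob {\<omega>\<in>space M. gw_Wlim xi m \<omega> > x}" by (rule up) simp
    finally show ?thesis .
  qed
qed

end

section \<open>Tails and almost sure convergence of \<open>W_n\<close>\<close>

locale heavy_galton_watson = galton_watson M F xi + heavy_offspring F m D \<delta> c
  for M :: "'a measure" and F xi m D \<delta> c
begin

lemma prob_gw_W: "prob {\<omega>\<in>space M. gw_W xi m n \<omega> > x} = Wtail n x"
proof -
  have "{\<omega>\<in>space M. gw_W xi m n \<omega> > x} = {\<omega>\<in>space M. gw_Z xi n \<omega> \<in> {k. real k > m ^ n * x}}"
    using m_gt1 by (auto simp: gw_W_def field_simps)
  then show ?thesis by (simp only: prob_gw_Z Wtail_def)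
qed

lemma prob_gw_W_increment:
  "prob {\<omega>\<in>space M. \<bar>gw_W xi m (Suc n) \<omega> - gw_W xi m n \<omega>\<bar> > q ^ n} \<le> 34 * V / m powr p * q ^ n"
proof -
  \<comment> \<open>This is \<open>q ^ n * m ^ Suc n\<close>; averaging the deviation bound over
    \<open>Z_n\<close> produces \<open>m ^ n / ((m * q) ^ n) powr p = q ^ n\<close>.\<close>
  let ?y = "m * (m * q) ^ n"
  have y: "?y > 0" using m_gt1 q_pos by simp
  have "\<bar>gw_W xi m (Suc n) \<omega> - gw_W xi m n \<omega>\<bar> > q ^ n \<longleftrightarrow> \<bar>real (gw_Z xi (Suc n) \<omega>) - real (gw_Z xi n \<omega>) * m\<bar> > ?y" for \<omega>
  proof -
    have "gw_W xi m (Suc n) \<omega> - gw_W xi m n \<omega> = (real (gw_Z xi (Suc n) \<omega>) - real (gw_Z xi n \<omega>) * m) / m ^ Suc n"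
      using m_gt1 by (simp add: gw_W_def field_simps del: gw_Z.simps)
    then have abs: "\<bar>gw_W xi m (Suc n) \<omega> - gw_W xi m n \<omega>\<bar> = \<bar>real (gw_Z xi (Suc n) \<omega>) - real (gw_Z xi n \<omega>) * m\<bar> / m ^ Suc n"
      using m_gt1 by (simp del: gw_Z.simps)
    have "?y = q ^ n * m ^ Suc n" by (simp add: power_mult_distrib)
    moreover have "m ^ Suc n > 0" using m_gt1 by simp
    ultimately show ?thesis unfolding abs by (simp only: pos_less_divide_eq)
  qed
  then have "prob {\<omega>\<in>space M. \<bar>gw_W xi m (Suc n) \<omega> - gw_W xi m n \<omega>\<bar> > q ^ n}
    = measure_pmf.expectation (generation_pmf F n) (\<lambda>k. measure_pmf.prob (sum_pmf F k) {b. \<bar>real b - real k * m\<bar> > ?y})"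
    using prob_gw_Z_step[of "\<lambda>k b. \<bar>real b - real k * m\<bar> > ?y" n] by (simp del: gw_Z.simps)
  also have "\<dots> \<le> measure_pmf.expectation (generation_pmf F n) (\<lambda>k. 34 * V / ?y powr p * real k)"
    by (rule integral_mono) (use integrable_generation_pmf sum_pmf_deviation[OF y] in auto)
  also have "\<dots> = 34 * V / ?y powr p * m ^ n"
    by (simp add: expectation_generation_pmf)
  also have "\<dots> = 34 * V / m powr p * q ^ n"
    using m_gt1 q_pos by (simp add: powr_mult mq_power_powr)
  finally show ?thesis .
qed

lemma AE_gw_W_converges: "AE \<omega> in M. (\<lambda>n. gw_W xi m n \<omega>) \<longlonglongrightarrow> gw_Wlim xi m \<omega>"
proof -
  let ?A = "\<lambda>n. {\<omega>\<in>space M. \<bar>gw_W xi m (Suc n) \<omega> - gw_W xi m n \<omega>\<bar> > q ^ n}"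
  have sq: "summable (\<lambda>n. q ^ n)" using q_pos q_less_1 by (intro summable_geometric) auto
  have "AE \<omega> in M. eventually (\<lambda>n. \<omega> \<in> space M - ?A n) sequentially"
  proof (rule borel_cantelli_AE1)
    show "summable (\<lambda>n. prob (?A n))"
      by (rule summable_comparison_test'[OF summable_mult[OF sq, of "34 * V / m powr p"]])
        (use prob_gw_W_increment in auto)
  qed (auto simp: emeasure_eq_measure)
  then show ?thesis
  proof eventually_elim
    case (elim \<omega>)
    then have "eventually (\<lambda>n. norm (gw_W xi m (Suc n) \<omega> - gw_W xi m n \<omega>) \<le> q ^ n) sequentially"
      by eventually_elim auto
    then have "summable (\<lambda>n. gw_W xi m (Suc n) \<omega> - gw_W xi m n \<omega>)"
      by (rule summable_comparison_test_ev[OF _ sq])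
    moreover have "(\<Sum>n<N. gw_W xi m (Suc n) \<omega> - gw_W xi m n \<omega>) = gw_W xi m N \<omega> - gw_W xi m 0 \<omega>" for N
      by (rule sum_lessThan_telescope)
    ultimately have "convergent (\<lambda>n. gw_W xi m n \<omega> - gw_W xi m 0 \<omega>)"
      by (simp only: summable_iff_convergent)
    then have "convergent (\<lambda>n. gw_W xi m n \<omega>)"
      by (simp add: convergent_diff_const_right_iff)
    then show ?case unfolding gw_Wlim_def by (simp add: convergent_LIMSEQ_iff)
  qed
qed

end

section \<open>The infinite series\<close>

context heavy_offspring
begin

definition Ginf :: "real \<Rightarrow> real" where
  "Ginf x = (\<Sum>i. m ^ i * Fbar F (m ^ (i + 1) * x))"

lemma summable_G:
  assumes "x > 1"
  shows "summable (\<lambda>i. m ^ i * Fbar F (m ^ (i + 1) * x))"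
proof -
  obtain C where C: "C \<ge> 1" "\<And>i x. x > 1 \<Longrightarrow> m ^ i * Fbar F (m ^ (i + 1) * x) \<le> C * \<theta> ^ i * Fbar F x"
    using G_term_bound by blast
  show ?thesis
  proof (rule summable_comparison_test')
    show "summable (\<lambda>i. C * \<theta> ^ i * Fbar F x)"
      using theta_pos theta_less_1 by (intro summable_mult summable_mult2 summable_geometric) auto
    show "norm (m ^ i * Fbar F (m ^ (i + 1) * x)) \<le> C * \<theta> ^ i * Fbar F x" for i
      using C(2)[OF assms, of i] m_gt1 by simp
  qed
qed

lemma G_tendsto_Ginf: "x > 1 \<Longrightarrow> (\<lambda>n. G n x) \<longlonglongrightarrow> Ginf x"
  unfolding G_def Ginf_def using summable_LIMSEQ[OF summable_G] by simp

lemma G_le_Ginf: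
  assumes "x > 1" shows "G n x \<le> Ginf x"
  by (rule LIMSEQ_le_const[OF G_tendsto_Ginf[OF assms]]) (use G_mono in blast)

lemma Ginf_le_G:
  obtains C where "C \<ge> 1" "\<And>N x. x > 1 \<Longrightarrow> Ginf x \<le> G N x + C * \<theta> ^ N * Fbar F x"
proof -
  obtain C where C: "C \<ge> 1" "\<And>N n x. N \<le> n \<Longrightarrow> x > 1 \<Longrightarrow> G n x \<le> G N x + C * \<theta> ^ N * Fbar F x"
    using G_tail_bound by blast
  have "Ginf x \<le> G N x + C * \<theta> ^ N * Fbar F x" if "x > 1" for N x
    by (rule LIMSEQ_le_const2[OF G_tendsto_Ginf[OF that]]) (use C(2) that in blast)
  with C(1) that show ?thesis by blast
qed

text \<open>The term \<open>i = 0\<close> of \<open>G\<close> is already comparable with the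
  offspring tail; this turns errors relative to \<open>Fbar F x\<close> into errors relative to the
  series. \<open>G 0\<close> is the empty sum, hence \<open>n \<ge> 1\<close>.\<close>

lemma Fbar_le_G:
  obtains C where "C \<ge> 1" "\<And>n x. n \<ge> 1 \<Longrightarrow> x \<ge> 0 \<Longrightarrow> Fbar F x \<le> C * G n x"
proof -
  obtain C where C: "C \<ge> 1" "\<And>x. x \<ge> 0 \<Longrightarrow> Fbar F (1 / m * x) \<le> C * Fbar F x"
    using Fbar_scale[of "1 / m"] m_gt1 by auto
  have "Fbar F x \<le> C * G n x" if "n \<ge> 1" "x \<ge> 0" for n x
  proof -
    have "Fbar F x = Fbar F (1 / m * (m * x))" using m_gt1 by simp
    also have "\<dots> \<le> C * Fbar F (m * x)" using m_gt1 that by (intro C(2)) auto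
    also have "Fbar F (m * x) = G 1 x" by (simp add: G_def)
    also have "C * G 1 x \<le> C * G n x" using C that by (intro mult_left_mono G_mono) auto
    finally show ?thesis .
  qed
  with C(1) that show ?thesis by blast
qed

end

section \<open>Relative asymptotics of the tails of \<open>W_n\<close> and \<open>W\<close>\<close>

locale irv_galton_watson = heavy_galton_watson M F xi m D \<delta> c + irv_offspring F m D \<delta> c
  for M :: "'a measure" and F xi m D \<delta> c
begin

lemma gw_W_tail_uniform:
  assumes "e > 0"
  shows "\<exists>X. \<forall>x\<ge>X. \<forall>n\<ge>1. \<bar>prob {\<omega>\<in>space M. gw_W xi m n \<omega> > x}
    / (\<Sum>i<n. m ^ i * Fbar F (m ^ (i + 1) * x)) - 1\<bar> < e"
proof -
  obtain C where C: "C \<ge> 1" "\<And>n x. n \<ge> 1 \<Longrightarrow> x \<ge> 0 \<Longrightarrow> Fbar F x \<le> C * G n x"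
    using Fbar_le_G by blast
  have "eventually (\<lambda>x. \<forall>n. \<bar>Wtail n x - G n x\<bar> \<le> e / (2 * C) * Fbar F x) at_top"
    by (rule Wtail_asymptotic_uniform) (use assms C in simp)
  then have "eventually (\<lambda>x. \<forall>n\<ge>1. \<bar>Wtail n x / G n x - 1\<bar> < e) at_top"
    using eventually_ge_at_top[of 0]
  proof eventually_elim
    case (elim x)
    show ?case
    proof (intro allI impI)
      fix n :: nat assume n: "n \<ge> 1"
      have "0 < C * G n x" using Fbar_pos[of x] C(2)[OF n, of x] elim by linarith
      then have Gpos: "G n x > 0" using C(1) by (simp add: zero_less_mult_iff)
      have "\<bar>Wtail n x - G n x\<bar> \<le> e / (2 * C) * Fbar F x" using elim by blast
      also have "\<dots> \<le> e / (2 * C) * (C * G n x)" using assms C n elim by (intro mult_left_mono C(2)) auto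
      also have "\<dots> = e / 2 * G n x" using C by simp
      also have "\<dots> < e * G n x" using assms Gpos by simp
      finally have "\<bar>Wtail n x - G n x\<bar> / G n x < e" using Gpos by (simp add: field_simps)
      moreover have "Wtail n x / G n x - 1 = (Wtail n x - G n x) / G n x" using Gpos by (simp add: field_simps)
      ultimately show "\<bar>Wtail n x / G n x - 1\<bar> < e" using Gpos by simp
    qed
  qed
  then show ?thesis by (simp add: prob_gw_W G_def eventually_at_top_linorder)
qed

text \<open>The filter \<open>H\<close> and the level \<open>g\<close> cover the joint limit in
  \<open>x\<close> and \<open>n\<close> as well as the limit in \<open>x\<close> alone.\<close>

lemma smallo_Ginf:
  assumes ev: "\<And>e. e > 0 \<Longrightarrow> eventually (\<lambda>z. \<bar>f z\<bar> \<le> e * Fbar F (g z)) H" and g: "filterlim g at_top H"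
  shows "f \<in> o[H](\<lambda>z. Ginf (g z))"
proof (rule landau_o.smallI)
  fix e :: real assume e: "e > 0"
  obtain C where C: "C \<ge> 1" "\<And>n x. n \<ge> 1 \<Longrightarrow> x \<ge> 0 \<Longrightarrow> Fbar F x \<le> C * G n x"
    using Fbar_le_G by blast
  have "eventually (\<lambda>z. g z > 1) H" using eventually_gt_at_top[of 1] g by (rule eventually_compose_filterlim)
  moreover have "eventually (\<lambda>z. \<bar>f z\<bar> \<le> (e / C) * Fbar F (g z)) H" by (rule ev) (use e C in simp)
  ultimately show "eventually (\<lambda>z. norm (f z) \<le> e * norm (Ginf (g z))) H"
  proof eventually_elim
    case (elim z)
    have "Fbar F (g z) \<le> C * G 1 (g z)" using elim by (intro C(2)) auto
    also have "\<dots> \<le> C * Ginf (g z)" using elim C by (intro mult_left_mono G_le_Ginf) auto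
    finally have le: "Fbar F (g z) \<le> C * Ginf (g z)" .
    have "\<bar>f z\<bar> \<le> (e / C) * Fbar F (g z)" by fact
    also have "\<dots> \<le> (e / C) * (C * Ginf (g z))" using e C le by (intro mult_left_mono) auto
    also have "\<dots> = e * Ginf (g z)" using C by simp
    finally show ?case using e by (smt (verit) mult_left_mono real_norm_def)
  qed
qed

lemma gw_W_tail_joint:
  "(\<lambda>(x, n). prob {\<omega>\<in>space M. gw_W xi m n \<omega> > x}) \<sim>[at_top \<times>\<^sub>F sequentially]
    (\<lambda>(x, n). \<Sum>i. m ^ i * Fbar F (m ^ (i + 1) * x))"
proof -
  have "(\<lambda>z. Wtail (snd z) (fst z) - Ginf (fst z)) \<in> o[at_top \<times>\<^sub>F sequentially](\<lambda>z. Ginf (fst z))"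
  proof (rule smallo_Ginf)
    fix e :: real assume e: "e > 0"
    obtain C where C: "C \<ge> 1" "\<And>N x. x > 1 \<Longrightarrow> Ginf x \<le> G N x + C * \<theta> ^ N * Fbar F x"
      using Ginf_le_G by blast
    have "(\<lambda>n. C * \<theta> ^ n) \<longlonglongrightarrow> C * 0"
      using theta_pos theta_less_1 by (intro tendsto_mult tendsto_const LIMSEQ_power_zero) auto
    then have "eventually (\<lambda>n. C * \<theta> ^ n < e / 2) sequentially"
      by (rule order_tendstoD(2)) (use e in simp)
    moreover have "eventually (\<lambda>x. (\<forall>n. \<bar>Wtail n x - G n x\<bar> \<le> e / 2 * Fbar F x) \<and> x > 1) at_top"
      by (intro eventually_conj Wtail_asymptotic_uniform eventually_gt_at_top) (use e in simp)
    ultimately have "eventually (\<lambda>z. ((\<forall>n. \<bar>Wtail n (fst z) - G n (fst z)\<bar> \<le> e / 2 * Fbar F (fst z)) \<and> fst z > 1)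
        \<and> C * \<theta> ^ snd z < e / 2) (at_top \<times>\<^sub>F sequentially)"
      by (intro eventually_prodI)
    then show "eventually (\<lambda>z. \<bar>Wtail (snd z) (fst z) - Ginf (fst z)\<bar> \<le> e * Fbar F (fst z)) (at_top \<times>\<^sub>F sequentially)"
    proof eventually_elim
      case (elim z)
      have x: "fst z > 1" using elim by blast
      have "\<bar>Wtail (snd z) (fst z) - G (snd z) (fst z)\<bar> \<le> e / 2 * Fbar F (fst z)" using elim by blast
      moreover have "C * \<theta> ^ snd z * Fbar F (fst z) \<le> e / 2 * Fbar F (fst z)"
        using elim by (intro mult_right_mono) auto
      ultimately show ?case using C(2)[OF x, of "snd z"] G_le_Ginf[OF x, of "snd z"] by linarith
    qed
  qed (rule filterlim_fst)
  from smallo_imp_asymp_equiv[OF this] show ?thesis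
    by (simp only: prob_gw_W Ginf_def case_prod_unfold)
qed

lemma gw_Wlim_tail:
  "(\<lambda>x. prob {\<omega>\<in>space M. gw_Wlim xi m \<omega> > x}) \<sim>[at_top] (\<lambda>x. \<Sum>i. m ^ i * Fbar F (m ^ (i + 1) * x))"
proof -
  have "(\<lambda>x. prob {\<omega>\<in>space M. gw_Wlim xi m \<omega> > x} - Ginf x) \<in> o[at_top](\<lambda>x. Ginf x)"
  proof (rule smallo_Ginf)
    fix e :: real assume e: "e > 0"
    then have e2: "e / 2 > 0" by simp
    obtain C where C: "C \<ge> 1" "\<And>N x. x > 1 \<Longrightarrow> Ginf x \<le> G N x + C * \<theta> ^ N * Fbar F x"
      using Ginf_le_G by blast
    have "(\<lambda>n. C * \<theta> ^ n) \<longlonglongrightarrow> C * 0"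
      using theta_pos theta_less_1 by (intro tendsto_mult tendsto_const LIMSEQ_power_zero) auto
    then have "eventually (\<lambda>n. C * \<theta> ^ n < e / 2) sequentially"
      by (rule order_tendstoD(2)) (use e in simp)
    then obtain N where N: "\<And>n. n \<ge> N \<Longrightarrow> C * \<theta> ^ n < e / 2" by (auto simp: eventually_sequentially)
    obtain \<eta> where eta: "0 < \<eta>" "\<eta> \<le> 1 / 2" and win: 
      "\<And>I. (\<And>e. e > 0 \<Longrightarrow> eventually (\<lambda>x. \<forall>N\<in>I. \<bar>Wtail N x - G N x\<bar> \<le> e * Fbar F x) at_top) \<Longrightarrow>
       eventually (\<lambda>x. \<forall>N\<in>I. Wtail N (x * (1 - \<eta>)) \<le> G N x + e / 2 * Fbar F x
         \<and> G N x - e / 2 * Fbar F x \<le> Wtail N (x * (1 + \<eta>))) at_top"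
      using Wtail_window[OF e2] by blast
    \<comment> \<open>The limit in \<open>n\<close> is taken at fixed \<open>x\<close>, so one
      threshold has to serve all generations.\<close>
    have "eventually (\<lambda>x. \<forall>N\<in>UNIV. Wtail N (x * (1 - \<eta>)) \<le> G N x + e / 2 * Fbar F x
         \<and> G N x - e / 2 * Fbar F x \<le> Wtail N (x * (1 + \<eta>))) at_top"
      by (rule win) (use Wtail_asymptotic_uniform in simp)
    then show "eventually (\<lambda>x. \<bar>prob {\<omega>\<in>space M. gw_Wlim xi m \<omega> > x} - Ginf x\<bar> \<le> e * Fbar F x) at_top"
      using eventually_gt_at_top[of 1]
    proof eventually_elim
      case (elim x)
      have "x * (1 - \<eta>) < x" "x < x * (1 + \<eta>)" using eta elim by (simp_all add: algebra_simps)
      note bounds = prob_gw_Wlim_bounds(1)[OF AE_gw_W_converges this(1)] prob_gw_Wlim_bounds(2)[OF AE_gw_W_converges this(2)]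
      have "prob {\<omega>\<in>space M. gw_Wlim xi m \<omega> > x} \<le> Ginf x + e / 2 * Fbar F x"
      \<comment> \<open>From above \<open>G n x \<le> Ginf x\<close> holds for all \<open>n\<close>;
        the lower bound has to wait until the remainder of the series is small, hence
        \<open>N\<close> there.\<close>
      proof (rule bounds(1)[where N=0], unfold prob_gw_W)
        fix n
        have "Wtail n (x * (1 - \<eta>)) \<le> G n x + e / 2 * Fbar F x" using elim by blast
        with G_le_Ginf[OF elim(2), of n] show "Wtail n (x * (1 - \<eta>)) \<le> Ginf x + e / 2 * Fbar F x" by linarith
      qed
      moreover have "Ginf x - e * Fbar F x \<le> prob {\<omega>\<in>space M. gw_Wlim xi m \<omega> > x}"
      proof (rule bounds(2)[where N=N], unfold prob_gw_W)
        fix n assume "n \<ge> N"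
        have "G n x - e / 2 * Fbar F x \<le> Wtail n (x * (1 + \<eta>))" using elim by blast
        moreover have "C * \<theta> ^ n * Fbar F x \<le> e / 2 * Fbar F x"
          using N[OF \<open>n \<ge> N\<close>] by (intro mult_right_mono) auto
        ultimately show "Ginf x - e * Fbar F x \<le> Wtail n (x * (1 + \<eta>))" using C(2)[OF elim(2), of n] by linarith
      qed
      moreover have "e / 2 * Fbar F x \<le> e * Fbar F x" using e by (intro mult_right_mono) auto
      ultimately show ?case by linarith
    qed
  qed (rule filterlim_ident)
  from smallo_imp_asymp_equiv[OF this] show ?thesis
    by (simp add: Ginf_def)
qed

end

theorem theorem1:
  fixes M :: "'a measure" and F :: "nat pmf" and xi :: "nat \<Rightarrow> nat \<Rightarrow> 'a \<Rightarrow> nat"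
    and m :: real
  assumes "prob_space M"
    and "prob_space.indep_vars M (\<lambda>_. count_space UNIV) (\<lambda>p. xi (fst p) (snd p)) UNIV"
    and "\<And>i n. distr M (count_space UNIV) (xi i n) = measure_pmf F"
    and "m = offspring_mean F" and "m > 1"
    and "dominated_varying F"
    and "\<exists>\<delta>>0. \<exists>c::real. \<forall>x y::real. x > 1 \<longrightarrow> y > 1 \<longrightarrow>
            Fbar F (x * y) \<le> c * Fbar F x / y powr (1 + \<delta>)"
  shows "(\<exists>c1>0. \<exists>c2. \<forall>x. \<forall>n\<ge>1.
            c1 * Fbar F x \<le> measure M {\<omega>\<in>space M. gw_W xi m n \<omega> > x} \<and>
            measure M {\<omega>\<in>space M. gw_W xi m n \<omega> > x} \<le> c2 * Fbar F x)
       \<and> (intermediate_regularly_varying F \<longrightarrow>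
            (\<forall>e>0. \<exists>X. \<forall>x\<ge>X. \<forall>n\<ge>1.
               \<bar>measure M {\<omega>\<in>space M. gw_W xi m n \<omega> > x}
                  / (\<Sum>i<n. m ^ i * Fbar F (m ^ (i + 1) * x)) - 1\<bar> < e)
          \<and> (\<lambda>(x, n). measure M {\<omega>\<in>space M. gw_W xi m n \<omega> > x})
              \<sim>[at_top \<times>\<^sub>F sequentially]
            (\<lambda>(x, n). \<Sum>i. m ^ i * Fbar F (m ^ (i + 1) * x))
          \<and> (\<lambda>x. measure M {\<omega>\<in>space M. gw_Wlim xi m \<omega> > x})
              \<sim>[at_top] (\<lambda>x. \<Sum>i. m ^ i * Fbar F (m ^ (i + 1) * x)))"
proof -
  obtain D where D: "\<And>x. Fbar F (x / 2) \<le> D * Fbar F x"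
    using assms(6) unfolding dominated_varying_def by blast
  obtain \<delta> c where \<delta>: "\<delta> > 0"
    and c: "\<And>x y. x > 1 \<Longrightarrow> y > 1 \<Longrightarrow> Fbar F (x * y) \<le> c * Fbar F x / y powr (1 + \<delta>)"
    using assms(7) by blast
  interpret prob_space M by fact
  interpret heavy_galton_watson M F xi m D \<delta> c
    using assms(2-5) D \<delta> c by unfold_locales
  show ?thesis
  proof (intro conjI impI)
    show "\<exists>c1>0. \<exists>c2. \<forall>x. \<forall>n\<ge>1. c1 * Fbar F x \<le> prob {\<omega>\<in>space M. gw_W xi m n \<omega> > x} \<and>
        prob {\<omega>\<in>space M. gw_W xi m n \<omega> > x} \<le> c2 * Fbar F x"
      unfolding prob_gw_W by (rule Wtail_bounds)
  next
    assume "intermediate_regularly_varying F"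
    then interpret irv_galton_watson M F xi m D \<delta> c by unfold_locales
    show "\<forall>e>0. \<exists>X. \<forall>x\<ge>X. \<forall>n\<ge>1. \<bar>prob {\<omega>\<in>space M. gw_W xi m n \<omega> > x}
        / (\<Sum>i<n. m ^ i * Fbar F (m ^ (i + 1) * x)) - 1\<bar> < e"
      using gw_W_tail_uniform by blast
    show "(\<lambda>(x, n). prob {\<omega>\<in>space M. gw_W xi m n \<omega> > x}) \<sim>[at_top \<times>\<^sub>F sequentially]
        (\<lambda>(x, n). \<Sum>i. m ^ i * Fbar F (m ^ (i + 1) * x))"
      by (rule gw_W_tail_joint)
    show "(\<lambda>x. prob {\<omega>\<in>space M. gw_Wlim xi m \<omega> > x}) \<sim>[at_top] (\<lambda>x. \<Sum>i. m ^ i * Fbar F (m ^ (i + 1) * x))"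
      by (rule gw_Wlim_tail)
  qed
qed

end
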